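(* Let $a,b,c,d\in\mathbb{R}_{+}$ be pairwise distinct (strictly) positive real numbers. Then the nodal sequences of the flat $4$-tori $T^+(a,b,c,d)$ and $T^-(a,b,c,d)$ are distinct; that is, writing $N_i^{\pm}$ for the multiset of nodal counts attached to the $i$-th positive eigenvalue (in increasing order, without repetition) of the Laplace-Beltrami operator on $T^{\pm}(a,b,c,d)$, there is an index $i\geq 1$ with $N_i^+\neq N_i^-$.
   Context: Flat tori. Let $v_1,\dots,v_n\in\mathbb{R}^n$ be linearly independent, let $A=[v_1,\dots,v_n]$ be the matrix with columns $v_i$, and let $T=\mathbb{R}^n/A\mathbb{Z}^n$. The Gram matrix is $G=A^{\top}A$ and $Q:=G^{-1}$. One writes $T=T(Q)$, since $Q$ determines the torus up to isometry. The Laplace-Beltrami operator $\Delta=-\sum_i \partial^2/\partial x_i^2$ on $T(Q)$ has spectrum $\{4\pi^2\, q^{\top}Qq : q\in\mathbb{Z}^n\}$. A vector $q\in\mathbb{Z}^n$ with $\lambda=4\pi^2 q^{\top}Qq$ is called a representing vector of the eigenvalue $\lambda$; the number of representing vectors of $\lambda$ (the degeneracy of $\lambda$) is finite and equals the dimension of its eigenspace, a basis of which is given by the functions $\Psi_q(x)=\exp\left(2\pi i\sum_j q_j v_j^*(x)\right)$, where $q$ runs through the representing vectors of $\lambda$ and $(v_j^* )$ is the basis dual to $(v_j)$. Nodal count. For each $q\in\mathbb{Z}^n$ one considers the real part $\Psi_q^{\mathrm{re}}$ or the imaginary part $\Psi_q^{\mathrm{im}}$ of $\Psi_q$, transforms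 it to the standard torus $\mathbb{R}^n/\mathbb{Z}^n$ (where these functions become $\cos(2\pi q^{\top}y)$ and $\sin(2\pi q^{\top}y)$), lifts it to $\mathbb{R}^n$, and counts its nodal domains (connected components of the complement of the zero set) in the unit cube, ignoring identifications at the boundary. The resulting nodal count of a representing vector $q$ is given by $$\nu(q)=2\sum_{i=1}^n|q_i|\ \text{ for } \Psi_q^{\mathrm{im}},\qquad \nu(q)=2\sum_{i=1}^n|q_i|+1\ \text{ for } \Psi_q^{\mathrm{re}}.$$ One of the two choices (real parts, or imaginary parts) is made for all $q$ and for both tori; the two choices differ only by adding $1$ to every nodal count, so whether two nodal sequences are distinct does not depend on the choice. Nodal sequence. Let $0<\lambda_1<\lambda_2<\dots$ be the distinct positive eigenvalues of $\Delta$ on $T(Q)$. The nodal sequence of $T(Q)$ is the sequence $(N_1,N_2,\dots)$, where $N_i$ is the finite collection, counted with multiplicity (a multiset), of the nodal counts $\nu(q)$ of all representing vectors $q\in\mathbb{Z}^n$ of $\lambda_i$; thus the cardinality of $N_i$ is the degeneracy of $\lambda_i$. The Conway-Sloane tori. For $a,b,c,d>0$ set $T^{\pm}(a,b,c,d):=T(Q^{\pm})$, where $Q^{\pm}=Q^{\pm}(a,b,c,d)$ are the $4\times4$ matrices $$Q^+=\frac{1}{12}\begin{bmatrix} 9a+b+c+d & 3a-3b-c+d & 3a+b-3c-d & 3a-b+c-3d\\ 3a-3b-c+d & a+9b+c+d & a-3b+3c-d & a+3b-c-3d\\ 3a+b-3c-d & a-3b+3c-d & a+b+9c+d & a-b-3c+3d\\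 3a-b+c-3d & a+3b-c-3d & a-b-3c+3d & a+b+c+9d \end{bmatrix},$$ $$Q^-=U^{\top}Q^+U,\qquad U=\frac12\begin{bmatrix} -1&1&1&1\\ -1&-1&-1&1\\ -1&1&-1&-1\\ -1&-1&1&-1 \end{bmatrix}.$$ It is known (Conway and Sloane) that $T^+(a,b,c,d)$ and $T^-(a,b,c,d)$ are isospectral, i.e. they have the same Laplace eigenvalues with the same multiplicities. *)

theory Defs
  imports "HOL-Analysis.Analysis" "HOL-Library.Multiset"
begin

text \<open>
  A flat torus \<open>\<real>\<^sup>n / A\<int>\<^sup>n\<close> is represented by its invertible basis matrix \<open>A\<close>, whose columns
  are the lattice basis vectors. Functions on the torus are \<open>A\<int>\<^sup>n\<close>-periodic functions on \<open>\<real>\<^sup>n\<close>.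
\<close>

definition int_vec :: "int ^ 'n \<Rightarrow> real ^ 'n" where
  "int_vec q = (\<chi> i. real_of_int (q $ i))"

definition gram :: "real ^ 'n ^ 'n \<Rightarrow> real ^ 'n ^ 'n" where
  "gram A = transpose A ** A"

definition inv_gram :: "real ^ 'n ^ 'n \<Rightarrow> real ^ 'n ^ 'n" where
  "inv_gram A = matrix_inv (gram A)"

definition torus_periodic :: "real ^ 'n ^ 'n \<Rightarrow> (real ^ 'n \<Rightarrow> complex) \<Rightarrow> bool" where
  "torus_periodic A f \<longleftrightarrow> (\<forall>x k. f (x + A *v int_vec k) = f x)"

definition partial_deriv :: "'n \<Rightarrow> (real ^ 'n \<Rightarrow> complex) \<Rightarrow> real ^ 'n \<Rightarrow> complex" where
  "partial_deriv i f x = frechet_derivative f (at x) (axis i 1)"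

definition smooth_fun :: "(real ^ 'n \<Rightarrow> complex) \<Rightarrow> bool" where
  "smooth_fun f \<longleftrightarrow> (\<forall>js x. foldr partial_deriv js f differentiable (at x))"

definition laplacian :: "(real ^ 'n \<Rightarrow> complex) \<Rightarrow> real ^ 'n \<Rightarrow> complex" where
  "laplacian f x = - (\<Sum>i\<in>UNIV. partial_deriv i (partial_deriv i f) x)"

definition torus_eigenvalue :: "real ^ 'n ^ 'n \<Rightarrow> real \<Rightarrow> bool" where
  "torus_eigenvalue A l \<longleftrightarrow>
     (\<exists>f. smooth_fun f \<and> torus_periodic A f \<and> (\<exists>x. f x \<noteq> 0) \<and>
          (\<forall>x. laplacian f x = complex_of_real l * f x))"

text \<open>
  The increasing enumeration \<open>0 = \<lambda>\<^sub>0 < \<lambda>\<^sub>1 < \<lambda>\<^sub>2 < \<dots>\<close> of the distinct eigenvalues; the positive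
  ones are those with index at least 1.
\<close>

primrec nth_eigenvalue :: "real ^ 'n ^ 'n \<Rightarrow> nat \<Rightarrow> real" where
  "nth_eigenvalue A 0 = 0"
| "nth_eigenvalue A (Suc i) = (LEAST l. torus_eigenvalue A l \<and> nth_eigenvalue A i < l)"

definition representing_vectors :: "real ^ 'n ^ 'n \<Rightarrow> real \<Rightarrow> (int ^ 'n) set" where
  "representing_vectors A l = {q. l = 4 * pi\<^sup>2 * (int_vec q \<bullet> (inv_gram A *v int_vec q))}"

text \<open>The \<open>j\<close>-th coordinate of \<open>A\<^sup>-\<^sup>1 x\<close> is the dual basis functional \<open>v\<^sub>j\<^sup>*\<close> at \<open>x\<close>.\<close>

definition torus_char :: "real ^ 'n ^ 'n \<Rightarrow> int ^ 'n \<Rightarrow> real ^ 'n \<Rightarrow> complex" where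
  "torus_char A q x =
     exp (2 * complex_of_real pi * \<i> *
       complex_of_real (\<Sum>j\<in>UNIV. real_of_int (q $ j) * (matrix_inv A *v x) $ j))"

text \<open>
  The argument \<open>P\<close> is \<open>Re\<close> or \<open>Im\<close>. Precomposition with \<open>A\<close> transforms the function to the
  standard torus \<open>\<real>\<^sup>n / \<int>\<^sup>n\<close>; \<open>cbox 0 1\<close> is the unit cube.
\<close>

definition nodal_count :: "(complex \<Rightarrow> real) \<Rightarrow> real ^ 'n ^ 'n \<Rightarrow> int ^ 'n \<Rightarrow> nat" where
  "nodal_count P A q = card (components {y \<in> cbox 0 1. P (torus_char A q (A *v y)) \<noteq> 0})"

definition nodal_sequence :: "(complex \<Rightarrow> real) \<Rightarrow> real ^ 'n ^ 'n \<Rightarrow> nat \<Rightarrow> nat multiset" where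
  "nodal_sequence P A i =
     image_mset (nodal_count P A) (mset_set (representing_vectors A (nth_eigenvalue A i)))"

definition Q_plus :: "real \<Rightarrow> real \<Rightarrow> real \<Rightarrow> real \<Rightarrow> real ^ 4 ^ 4" where
  "Q_plus a b c d = (1/12) *\<^sub>R vector
    [vector [9*a + b + c + d, 3*a - 3*b - c + d, 3*a + b - 3*c - d, 3*a - b + c - 3*d],
     vector [3*a - 3*b - c + d, a + 9*b + c + d, a - 3*b + 3*c - d, a + 3*b - c - 3*d],
     vector [3*a + b - 3*c - d, a - 3*b + 3*c - d, a + b + 9*c + d, a - b - 3*c + 3*d],
     vector [3*a - b + c - 3*d, a + 3*b - c - 3*d, a - b - 3*c + 3*d, a + b + c + 9*d]]"

definition U_mat :: "real ^ 4 ^ 4" where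
  "U_mat = (1/2) *\<^sub>R vector
    [vector [-1, 1, 1, 1],
     vector [-1, -1, -1, 1],
     vector [-1, 1, -1, -1],
     vector [-1, -1, 1, -1]]"

definition Q_minus :: "real \<Rightarrow> real \<Rightarrow> real \<Rightarrow> real \<Rightarrow> real ^ 4 ^ 4" where
  "Q_minus a b c d = transpose U_mat ** Q_plus a b c d ** U_mat"

text \<open>
  \<open>12 Q\<^sup>+ = B\<^sup>T diag(a, b, c, d) B\<close> for an integer matrix \<open>B\<close> with \<open>B\<^sup>T B = 12\<close>, and \<open>U\<close> is orthogonal;
  hence \<open>Q\<^sup>+\<close> and \<open>Q\<^sup>-\<close> are inverse Gram matrices of actual lattice bases.
\<close>

lemma vector_4_nth:
  "(vector [x, y, z, w] :: 'a::zero ^ 4) $ 1 = x" "(vector [x, y, z, w] :: 'a::zero ^ 4) $ 2 = y"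
  "(vector [x, y, z, w] :: 'a::zero ^ 4) $ 3 = z" "(vector [x, y, z, w] :: 'a::zero ^ 4) $ 4 = w"
  unfolding vector_def by auto

lemma neq_4: "(1::4) \<noteq> 2" "(1::4) \<noteq> 3" "(1::4) \<noteq> 4" "(2::4) \<noteq> 1" "(2::4) \<noteq> 3" "(2::4) \<noteq> 4"
  "(3::4) \<noteq> 1" "(3::4) \<noteq> 2" "(3::4) \<noteq> 4" "(4::4) \<noteq> 1" "(4::4) \<noteq> 2" "(4::4) \<noteq> 3"
  by auto

lemma U_mat_orthogonal: "transpose U_mat ** U_mat = mat 1"
  by (simp add: vec_eq_iff forall_4 matrix_matrix_mult_def sum_4 U_mat_def vector_4_nth
      transpose_def mat_def neq_4)

lemma inv_gramI:
  assumes "gram A ** Q = mat 1"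
  shows "invertible A \<and> inv_gram A = Q"
proof -
  have "Q ** gram A = mat 1" using assms matrix_left_right_inverse by blast
  hence "(Q ** transpose A) ** A = mat 1" by (simp add: gram_def matrix_mul_assoc)
  hence "invertible A" using invertible_left_inverse by blast
  moreover have "inv_gram A = Q"
    unfolding inv_gram_def matrix_inv_def
  proof (rule some_equality)
    show "gram A ** Q = mat 1 \<and> Q ** gram A = mat 1"
      using assms \<open>Q ** gram A = mat 1\<close> by blast
    show "R = Q" if "gram A ** R = mat 1 \<and> R ** gram A = mat 1" for R
      using that assms by (metis matrix_mul_assoc matrix_mul_lid matrix_mul_rid)
  qed
  ultimately show ?thesis by blast
qed

lemma Q_plus_realised:
  assumes "a > 0" "b > 0" "c > 0" "d > 0"
  shows "\<exists>A. invertible A \<and> inv_gram A = Q_plus a b c d"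
proof -
  define B :: "real ^ 4 ^ 4" where
    "B = vector [vector [3, 1, 1, 1], vector [1, -3, 1, -1], vector [1, -1, -3, 1], vector [1, 1, -1, -3]]"
  define D :: "real ^ 4 \<Rightarrow> real ^ 4 ^ 4" where "D v = (\<chi> i j. if i = j then v $ i else 0)" for v
  define r :: "real ^ 4" where "r = vector [1 / sqrt a, 1 / sqrt b, 1 / sqrt c, 1 / sqrt d]"
  define A where "A = (1 / sqrt 12) *\<^sub>R (D r ** B)"
  note defs = vec_eq_iff forall_4 matrix_matrix_mult_def sum_4 D_def vector_4_nth transpose_def
    mat_def neq_4
  have 1: "gram A = (1/12) *\<^sub>R (transpose B ** D (vector [1/a, 1/b, 1/c, 1/d]) ** B)"
  proof -
    have t: "transpose (D r) = D r" by (simp add: defs)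
    have "gram A = (1/12) *\<^sub>R (transpose B ** (D r ** D r) ** B)"
      unfolding gram_def A_def
      by (simp add: transpose_scalar matrix_transpose_mul t matrix_mul_assoc scalar_matrix_assoc
          matrix_scalar_ac flip: scalar_mult_eq_scaleR)
    also have "D r ** D r = D (vector [1/a, 1/b, 1/c, 1/d])"
      using assms by (simp add: defs r_def)
    finally show ?thesis .
  qed
  have 2: "Q_plus a b c d = (1/12) *\<^sub>R (transpose B ** D (vector [a, b, c, d]) ** B)"
    by (simp add: defs Q_plus_def B_def)
  have 3: "B ** transpose B = 12 *\<^sub>R mat 1"
    by (simp add: defs B_def)
  have 4: "D (vector [1/a, 1/b, 1/c, 1/d]) ** D (vector [a, b, c, d]) = mat 1"
    using assms by (simp add: defs)
  have 5: "transpose B ** B = 12 *\<^sub>R mat 1"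
    by (simp add: defs B_def)
  let ?E = "D (vector [1/a, 1/b, 1/c, 1/d])" and ?F = "D (vector [a, b, c, d])"
  have "gram A ** Q_plus a b c d = (1/144) *\<^sub>R (transpose B ** (?E ** (B ** transpose B) ** ?F) ** B)"
    unfolding 1 2
    by (simp add: matrix_mul_assoc matrix_scalar_ac scalar_matrix_assoc[symmetric])
  also have "?E ** (B ** transpose B) ** ?F = 12 *\<^sub>R (?E ** ?F)"
    unfolding 3 by (simp add: matrix_scalar_ac scalar_matrix_assoc[symmetric])
  also have "(1/144) *\<^sub>R (transpose B ** (12 *\<^sub>R (?E ** ?F)) ** B) = mat 1"
    unfolding 4 by (simp add: matrix_scalar_ac scalar_matrix_assoc[symmetric] 5)
  finally show ?thesis using inv_gramI by blast
qed

lemma Q_minus_realised: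
  assumes "a > 0" "b > 0" "c > 0" "d > 0"
  shows "\<exists>A. invertible A \<and> inv_gram A = Q_minus a b c d"
proof -
  obtain A where A: "invertible A" "inv_gram A = Q_plus a b c d"
    using Q_plus_realised[OF assms] by blast
  have "invertible (gram A)"
    using A(1) by (simp add: gram_def invertible_mult transpose_invertible)
  hence g: "gram A ** Q_plus a b c d = mat 1"
    unfolding A(2)[symmetric] inv_gram_def matrix_inv_def invertible_def
    by (rule someI2_ex) blast
  have U': "U_mat ** transpose U_mat = mat 1"
    using U_mat_orthogonal matrix_left_right_inverse by blast
  have "gram (A ** U_mat) ** Q_minus a b c d
      = transpose U_mat ** (gram A ** (U_mat ** transpose U_mat) ** Q_plus a b c d) ** U_mat"
    by (simp add: gram_def Q_minus_def matrix_transpose_mul matrix_mul_assoc)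
  also have "\<dots> = mat 1" by (simp add: U' g U_mat_orthogonal)
  finally show ?thesis using inv_gramI by blast
qed

end

theory Submission
  imports Defs
begin

text \<open>
  Let \<open>B\<close> be the integer matrix with \<open>12 Q\<^sup>+ = B\<^sup>T diag(a, b, c, d) B\<close>. On \<open>\<int>\<^sup>4\<close>, the form \<open>12 Q\<^sup>+\<close>
  is the linear form in \<open>(a, b, c, d)\<close> with coefficients the squared coordinates of \<open>Bq\<close>, and
  \<open>12 Q\<^sup>-\<close> is the one with coefficients the squared coordinates of \<open>BUq\<close>.

  The nodal count of \<open>q\<close> determines the \<open>\<ell>\<^sup>1\<close>-norm of \<open>q\<close>. Hence equal nodal sequences would force the
  multisets of values of \<open>Q\<^sup>+\<close> and \<open>Q\<^sup>-\<close> on each \<open>\<ell>\<^sup>1\<close>-sphere to agree. On the spheres of radius at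
  most 3 they do agree, because the coefficient vectors that occur are the same. On the sphere of radius
  4 the coefficient vectors that do not cancel are permutations of \<open>(100, 16, 4, 0)\<close> and of
  \<open>(64, 36, 16, 4)\<close>, each in one parity class for \<open>Q\<^sup>+\<close> and in the other one for \<open>Q\<^sup>-\<close>. So the
  difference of the \<open>n\<close>-th power sums of the values is antisymmetric in \<open>a, b, c, d\<close>. It vanishes for
  \<open>n \<le> 7\<close>, but for \<open>n = 8\<close> it is a nonzero multiple of the Vandermonde product times the sum of the
  \<open>(a\<^sub>i - a\<^sub>j)\<^sup>2\<close>.

  To compare eigenvalues with equal index one needs the spectrum exactly: Green's formula and the
  density of the trigonometric polynomials show that the values of the dual form are the only
  eigenvalues.
\<close>

lemma matrix_inv_right: "A ** matrix_inv A = mat 1"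
  and matrix_inv_left: "matrix_inv A ** A = mat 1"
  if "invertible A" for A :: "real ^ 'n ^ 'n"
proof -
  have "\<exists>A'. A ** A' = mat 1 \<and> A' ** A = mat 1" using that by (simp add: invertible_def)
  from someI_ex[OF this] show "A ** matrix_inv A = mat 1" "matrix_inv A ** A = mat 1"
    by (simp_all add: matrix_inv_def)
qed

section \<open>The spectrum of a flat torus\<close>

lemma has_derivative_partial_deriv:
  fixes f :: "real ^ 'n \<Rightarrow> complex"
  assumes "f differentiable (at x)"
  shows "(f has_derivative (\<lambda>h. \<Sum>i\<in>UNIV. h $ i *\<^sub>R partial_deriv i f x)) (at x)"
proof -
  let ?D = "frechet_derivative f (at x)"
  have D: "(f has_derivative ?D) (at x)"
    using assms frechet_derivative_works by blast
  then interpret bounded_linear ?D by (rule has_derivative_bounded_linear)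
  have "?D h = (\<Sum>i\<in>UNIV. h $ i *\<^sub>R partial_deriv i f x)" for h
  proof -
    have "?D h = ?D (\<Sum>i\<in>UNIV. h $ i *\<^sub>R axis i 1)"
      by (simp add: basis_expansion flip: scalar_mult_eq_scaleR)
    then show ?thesis by (simp add: sum scaleR partial_deriv_def)
  qed
  then have "?D = (\<lambda>h. \<Sum>i\<in>UNIV. h $ i *\<^sub>R partial_deriv i f x)" ..
  with D show ?thesis by simp
qed

lemma partial_deriv_eqI:
  assumes "(f has_derivative D) (at x)"
  shows "partial_deriv i f x = D (axis i 1)"
  using frechet_derivative_at[OF assms] by (simp add: partial_deriv_def)

lemma partial_deriv_periodic:
  assumes "\<And>x. f (x + v) = f x" and "f differentiable (at (x + v))"
  shows "partial_deriv i f (x + v) = partial_deriv i f x"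
proof -
  let ?D = "frechet_derivative f (at (x + v))"
  have D: "(f has_derivative ?D) (at (x + v))"
    using assms(2) frechet_derivative_works by blast
  have "((\<lambda>x. f (x + v)) has_derivative (\<lambda>h. ?D h)) (at x)"
    by (rule has_derivative_compose[where f = "\<lambda>x. x + v" and f' = "\<lambda>h. h"])
      (auto intro!: derivative_eq_intros D)
  then have "(f has_derivative ?D) (at x)" by (simp add: assms(1))
  from partial_deriv_eqI[OF this] partial_deriv_eqI[OF D] show ?thesis by simp
qed

lemma smooth_funD:
  assumes "smooth_fun f"
  shows "f differentiable (at x)" "smooth_fun (partial_deriv i f)"
proof -
  show "f differentiable (at x)"
    using assms unfolding smooth_fun_def by (metis foldr.simps(1) id_apply)
  show "smooth_fun (partial_deriv i f)"
    unfolding smooth_fun_def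
  proof (intro allI)
    fix js x
    have "foldr partial_deriv (js @ [i]) f differentiable (at x)"
      using assms unfolding smooth_fun_def by blast
    then show "foldr partial_deriv js (partial_deriv i f) differentiable (at x)" by simp
  qed
qed

lemma smooth_fun_continuous: "smooth_fun f \<Longrightarrow> continuous_on S f"
  by (meson continuous_at_imp_continuous_on differentiable_imp_continuous_within smooth_funD(1))

section \<open>Integrals of periodic functions and of their derivatives over the cube\<close>

text \<open>The translated cube is cut where the \<open>k\<close>-th coordinate is 1. By periodicity
  the overhanging slab may be moved back by one period, where it fills the slab left free.\<close>

lemma integral_cube_shift:
  fixes K :: "real ^ 'n \<Rightarrow> complex"
  assumes cont: "continuous_on UNIV K" and per: "\<And>y. K (y + axis k 1) = K y"
    and t: "0 \<le> t" "t \<le> 1"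
  shows "integral (cbox 0 1) (\<lambda>y. K (y + t *\<^sub>R axis k 1)) = integral (cbox 0 1) K"
proof -
  define e :: "real ^ 'n" where "e = axis k 1"
  have e: "e \<in> Basis" by (simp add: e_def)
  have int: "K integrable_on cbox u v" for u v
    using cont continuous_on_subset integrable_continuous by blast
  have inner: "y \<bullet> e = y $ k" for y by (simp add: e_def inner_axis)
  have comp: "e $ i = (if i = k then 1 else 0)" for i by (simp add: e_def axis_def)
  have box: "x \<in> cbox u v \<longleftrightarrow> u $ k \<le> x $ k \<and> x $ k \<le> v $ k \<and> (\<forall>i. i \<noteq> k \<longrightarrow> u $ i \<le> x $ i \<and> x $ i \<le> v $ i)"
    for x u v :: "real ^ 'n"
    unfolding mem_box_cart by metis
  \<comment> \<open>The corner \<open>1 + t *\<^sub>R e - e\<close> has \<open>k\<close>-th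
    coordinate \<open>t\<close> and all others 1: the box in \<open>s3\<close> is the overhang of
    \<open>s2\<close> moved back by \<open>e\<close>.\<close>
  have s1: "cbox (t *\<^sub>R e) (1 + t *\<^sub>R e) \<inter> {x. x \<bullet> e \<le> 1} = cbox (t *\<^sub>R e) 1"
    and s2: "cbox (t *\<^sub>R e) (1 + t *\<^sub>R e) \<inter> {x. x \<bullet> e \<ge> 1} = cbox e (1 + t *\<^sub>R e)"
    and s3: "cbox 0 1 \<inter> {x. x \<bullet> e \<le> t} = cbox 0 (1 + t *\<^sub>R e - e)"
    and s4: "cbox 0 1 \<inter> {x. x \<bullet> e \<ge> t} = cbox (t *\<^sub>R e) 1"
    using t by (auto simp: set_eq_iff box inner comp)
  have "integral (cbox 0 1) (\<lambda>y. K (y + t *\<^sub>R e)) = integral (cbox (t *\<^sub>R e) (1 + t *\<^sub>R e)) K"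
    using integral_shift_cbox[of "t *\<^sub>R e" "t *\<^sub>R e" "1 + t *\<^sub>R e" K] by simp
  also have "\<dots> = integral (cbox (t *\<^sub>R e) 1) K + integral (cbox e (1 + t *\<^sub>R e)) K"
    using integral_split[OF int e, of "t *\<^sub>R e" "1 + t *\<^sub>R e" 1] by (simp only: s1 s2)
  also have "integral (cbox e (1 + t *\<^sub>R e)) K = integral (cbox 0 (1 + t *\<^sub>R e - e)) K"
    using integral_shift_cbox[of e e "1 + t *\<^sub>R e" K] per by (simp add: e_def)
  also have "integral (cbox (t *\<^sub>R e) 1) K + integral (cbox 0 (1 + t *\<^sub>R e - e)) K = integral (cbox 0 1) K"
    using integral_split[OF int e, of 0 1 t] by (simp only: s3 s4 add.commute)
  finally show ?thesis by (simp only: e_def)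
qed

lemma integral_cube_periodic_derivative:
  fixes H K :: "real ^ 'n \<Rightarrow> complex"
  assumes deriv: "\<And>y s. ((\<lambda>s. H (y + s *\<^sub>R axis k 1)) has_vector_derivative K (y + s *\<^sub>R axis k 1)) (at s)"
    and cont: "continuous_on UNIV K"
    and per: "\<And>y. H (y + axis k 1) = H y" "\<And>y. K (y + axis k 1) = K y"
  shows "integral (cbox 0 1) K = 0"
proof -
  let ?e = "axis k 1 :: real ^ 'n"
  \<comment> \<open>averaging over all shifts by \<open>t\<close> and integrating over \<open>t\<close> first gives \<open>H (y + e) - H y = 0\<close>\<close>
  have "integral (cbox 0 1) K = integral (cbox 0 1) (\<lambda>t::real. integral (cbox 0 1) K)" by simp
  also have "\<dots> = integral (cbox 0 1) (\<lambda>t::real. integral (cbox 0 1) (\<lambda>y. K (y + t *\<^sub>R ?e)))"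
    by (rule integral_cong) (use integral_cube_shift[OF cont per(2)] in simp)
  also have "\<dots> = integral (cbox 0 1) (\<lambda>y. integral (cbox 0 1) (\<lambda>t::real. K (y + t *\<^sub>R ?e)))"
    by (rule integral_swap_continuous)
      (auto intro!: continuous_intros continuous_on_compose2[OF cont] simp: case_prod_unfold)
  also have "\<dots> = integral (cbox 0 1) (\<lambda>y :: real ^ 'n. 0)"
  proof (rule integral_cong)
    fix y :: "real ^ 'n"
    have "((\<lambda>t. K (y + t *\<^sub>R ?e)) has_integral H (y + 1 *\<^sub>R ?e) - H (y + 0 *\<^sub>R ?e)) {0..1}"
      by (rule fundamental_theorem_of_calculus) (auto intro: has_vector_derivative_at_within deriv)
    then show "integral (cbox 0 1) (\<lambda>t::real. K (y + t *\<^sub>R ?e)) = 0"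
      by (simp add: per integral_unique)
  qed
  finally show ?thesis by simp
qed

lemma int_vec_axis: "int_vec (axis k 1) = axis k 1"
  by (simp add: int_vec_def vec_eq_iff axis_def)

text \<open>By the chain rule, the derivative of \<open>G (A *v y)\<close> along the
  \<open>k\<close>-th axis is a combination of the partial derivatives of \<open>G\<close> with
  coefficients from column \<open>k\<close> of \<open>A\<close>. It integrates to 0 for every
  \<open>k\<close>, and inverting this linear system isolates each partial derivative.\<close>

lemma integral_cube_partial_deriv:
  fixes G :: "real ^ 'n \<Rightarrow> complex"
  assumes A: "invertible A" and per: "torus_periodic A G"
    and diff: "\<And>x. G differentiable (at x)"
    and cont: "\<And>i. continuous_on UNIV (partial_deriv i G)"
  shows "integral (cbox 0 1) (\<lambda>y. partial_deriv j G (A *v y)) = 0"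
proof -
  define I where "I i = integral (cbox 0 1) (\<lambda>y. partial_deriv i G (A *v y))" for i
  have cA: "continuous_on S (\<lambda>y. A *v y)" for S
    using linear_continuous_on matrix_vector_mul_bounded_linear by blast
  have cont': "continuous_on S (\<lambda>y. partial_deriv i G (A *v y))" for i S
    by (rule continuous_on_compose2[OF cont cA]) auto
  have per': "G (x + A *v axis k 1) = G x" for x k
    using per unfolding torus_periodic_def by (metis int_vec_axis)
  have "(\<Sum>i\<in>UNIV. A $ i $ k *\<^sub>R I i) = 0" for k
  proof -
    have "integral (cbox 0 1) (\<lambda>y. \<Sum>i\<in>UNIV. A $ i $ k *\<^sub>R partial_deriv i G (A *v y)) = 0"
    proof (rule integral_cube_periodic_derivative[where H = "\<lambda>y. G (A *v y)" and k = k])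
      fix y and s :: real
      have "((\<lambda>s. A *v (y + s *\<^sub>R axis k 1)) has_vector_derivative A *v axis k 1) (at s)"
      proof -
        have "((\<lambda>s. A *v y + s *\<^sub>R (A *v axis k 1)) has_vector_derivative A *v axis k 1) (at s)"
          by (auto intro!: derivative_eq_intros)
        then show ?thesis by (simp add: matrix_vector_right_distrib matrix_vector_mult_scaleR)
      qed
      from has_derivative_compose[OF this[unfolded has_vector_derivative_def] has_derivative_partial_deriv[OF diff]]
      show "((\<lambda>s. G (A *v (y + s *\<^sub>R axis k 1))) has_vector_derivative
          (\<Sum>i\<in>UNIV. A $ i $ k *\<^sub>R partial_deriv i G (A *v (y + s *\<^sub>R axis k 1)))) (at s)"
        by (simp add: has_vector_derivative_def scaleR_sum_right matrix_vector_mult_basis column_def)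
    next
      show "continuous_on UNIV (\<lambda>y. \<Sum>i\<in>UNIV. A $ i $ k *\<^sub>R partial_deriv i G (A *v y))"
        by (intro continuous_intros cont')
    qed (simp_all add: matrix_vector_right_distrib per' partial_deriv_periodic[OF per' diff])
    also have "integral (cbox 0 1) (\<lambda>y. \<Sum>i\<in>UNIV. A $ i $ k *\<^sub>R partial_deriv i G (A *v y))
        = (\<Sum>i\<in>UNIV. A $ i $ k *\<^sub>R I i)"
      unfolding I_def
      by (subst integral_sum) (auto intro!: integrable_continuous continuous_intros cont')
    finally show ?thesis .
  qed
  \<comment> \<open>Column \<open>j\<close> of the inverse matrix solves the system for
    \<open>I j\<close>.\<close>
  then have "0 = (\<Sum>k\<in>UNIV. matrix_inv A $ k $ j *\<^sub>R (\<Sum>i\<in>UNIV. A $ i $ k *\<^sub>R I i))" by simp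
  also have "\<dots> = (\<Sum>i\<in>UNIV. (\<Sum>k\<in>UNIV. A $ i $ k * matrix_inv A $ k $ j) *\<^sub>R I i)"
    unfolding scaleR_sum_right scaleR_sum_left by (subst sum.swap) (simp add: mult.commute)
  also have "\<dots> = (\<Sum>i\<in>UNIV. (A ** matrix_inv A) $ i $ j *\<^sub>R I i)"
    by (simp add: matrix_matrix_mult_def)
  also have "\<dots> = I j"
    by (simp add: matrix_inv_right[OF A] mat_def if_distrib[of "\<lambda>x. x *\<^sub>R _"] cong: if_cong)
  finally show ?thesis by (simp add: I_def)
qed

text \<open>\<open>G\<close> is the \<open>i\<close>-th component of the field in Green's second
  identity. For \<open>j = i\<close> the products of first derivatives cancel; general
  \<open>j\<close> is kept because the divergence theorem asks for continuity of all partial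
  derivatives.\<close>

lemma partial_deriv_diff_mult:
  fixes i :: "'n :: finite"
  assumes "smooth_fun f" "smooth_fun g"
  defines "G \<equiv> \<lambda>x. f x * partial_deriv i g x - g x * partial_deriv i f x"
  shows "G differentiable (at x)"
    and "partial_deriv j G x = f x * partial_deriv j (partial_deriv i g) x + partial_deriv j f x * partial_deriv i g x
        - (g x * partial_deriv j (partial_deriv i f) x + partial_deriv j g x * partial_deriv i f x)"
proof -
  have *: "smooth_fun h \<Longrightarrow> (h has_derivative frechet_derivative h (at x)) (at x)" for h
    using frechet_derivative_works smooth_funD(1) by blast
  note d = has_derivative_diff[OF has_derivative_mult[OF *[OF assms(1)] *[OF smooth_funD(2)[OF assms(2)]]]
      has_derivative_mult[OF *[OF assms(2)] *[OF smooth_funD(2)[OF assms(1)]]], of i i, folded G_def]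
  show "G differentiable (at x)" using d differentiable_def by blast
  show "partial_deriv j G x = f x * partial_deriv j (partial_deriv i g) x + partial_deriv j f x * partial_deriv i g x
        - (g x * partial_deriv j (partial_deriv i f) x + partial_deriv j g x * partial_deriv i f x)"
    unfolding partial_deriv_eqI[OF d] by (simp add: partial_deriv_def)
qed


section \<open>Characters are eigenfunctions and orthogonal to other eigenspaces\<close>

lemma torus_char_eq:
  "torus_char A q x = cis (2 * pi * ((transpose (matrix_inv A) *v int_vec q) \<bullet> x))"
proof -
  have "(\<Sum>j\<in>UNIV. real_of_int (q $ j) * (matrix_inv A *v x) $ j) = int_vec q \<bullet> (matrix_inv A *v x)"
    by (simp add: inner_vec_def int_vec_def)
  also have "\<dots> = (transpose (matrix_inv A) *v int_vec q) \<bullet> x"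
    by (simp add: dot_lmul_matrix)
  finally show ?thesis by (simp add: torus_char_def cis_conv_exp mult_ac)
qed

text \<open>The constant \<open>c\<close> makes the class of functions stable under partial
  derivatives, so that iterated derivatives follow by induction.\<close>

lemma partial_deriv_cis:
  fixes p :: "real ^ 'n"
  defines "f \<equiv> \<lambda>x. cis (2 * pi * (p \<bullet> x))"
  shows "(\<lambda>x. c * f x) differentiable (at x)"
    and "partial_deriv i (\<lambda>x. c * f x) = (\<lambda>x. (2 * pi * p $ i * \<i> * c) * f x)"
proof -
  have D: "((\<lambda>x. c * f x) has_derivative (\<lambda>h. c * ((2 * pi * (p \<bullet> h)) *\<^sub>R (\<i> * f x)))) (at x)" for x
    unfolding f_def
    by (rule derivative_eq_intros refl | simp)+
  show "(\<lambda>x. c * f x) differentiable (at x)" using D differentiable_def by blast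
  show "partial_deriv i (\<lambda>x. c * f x) = (\<lambda>x. (2 * pi * p $ i * \<i> * c) * f x)"
    unfolding partial_deriv_eqI[OF D] fun_eq_iff
    by (simp add: inner_axis scaleR_conv_of_real mult_ac)
qed

lemma smooth_torus_char: "smooth_fun (torus_char A q)"
proof -
  let ?f = "\<lambda>x. cis (2 * pi * ((transpose (matrix_inv A) *v int_vec q) \<bullet> x))"
  have "\<exists>c. foldr partial_deriv js ?f = (\<lambda>x. c * ?f x)" for js
  proof (induction js)
    case Nil
    show ?case by (rule exI[of _ 1]) simp
  next
    case (Cons i js)
    then show ?case using partial_deriv_cis(2) by (metis foldr.simps(2) o_apply)
  qed
  then show ?thesis
    unfolding smooth_fun_def torus_char_eq[abs_def] by (metis partial_deriv_cis(1))
qed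

lemma torus_char_periodic:
  assumes "invertible A"
  shows "torus_periodic A (torus_char A q)"
proof -
  have "int_vec q \<bullet> int_vec k \<in> \<int>" for k
    by (auto simp: inner_vec_def int_vec_def)
  then have *: "cis (2 * pi * (int_vec q \<bullet> int_vec k)) = 1" for k
    using cis_multiple_2pi by blast
  have "(transpose (matrix_inv A) *v int_vec q) \<bullet> (A *v int_vec k) = int_vec q \<bullet> int_vec k" for k
    using matrix_inv_left[OF assms] by (simp add: dot_lmul_matrix matrix_vector_mul_assoc)
  then show ?thesis
    by (simp add: torus_periodic_def torus_char_eq inner_add_right distrib_left * flip: cis_mult)
qed

lemma inv_gram_eq:
  fixes A :: "real ^ 'n ^ 'n"
  assumes "invertible A"
  shows "inv_gram A = matrix_inv A ** transpose (matrix_inv A)"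
proof -
  have "gram A ** (matrix_inv A ** transpose (matrix_inv A)) = transpose A ** (A ** matrix_inv A) ** transpose (matrix_inv A)"
    by (simp add: gram_def matrix_mul_assoc)
  also have "\<dots> = transpose (matrix_inv A ** A)"
    by (simp add: matrix_inv_right[OF assms] matrix_transpose_mul)
  also have "\<dots> = mat 1" by (simp add: matrix_inv_left[OF assms])
  finally show ?thesis using inv_gramI by blast
qed

lemma laplacian_torus_char:
  fixes A :: "real ^ 'n ^ 'n"
  assumes "invertible A"
  shows "laplacian (torus_char A q) x
       = complex_of_real (4 * pi\<^sup>2 * (int_vec q \<bullet> (inv_gram A *v int_vec q))) * torus_char A q x"
proof -
  define p where "p = transpose (matrix_inv A) *v int_vec q"
  have "int_vec q \<bullet> (inv_gram A *v int_vec q) = p \<bullet> p"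
    by (simp add: inv_gram_eq[OF assms] p_def dot_lmul_matrix flip: matrix_vector_mul_assoc)
  moreover have "laplacian (\<lambda>x. 1 * cis (2 * pi * (p \<bullet> x))) x
      = complex_of_real (4 * pi\<^sup>2 * (p \<bullet> p)) * cis (2 * pi * (p \<bullet> x))"
    unfolding laplacian_def partial_deriv_cis(2)
    by (simp add: inner_vec_def sum_distrib_left sum_distrib_right power2_eq_square mult_ac flip: sum_negf)
  ultimately show ?thesis by (simp add: torus_char_eq[abs_def] p_def)
qed

text \<open>Green's formula multiplies the integral by \<open>l - m\<close>, which is nonzero. The
  character enters without conjugation, so this is the Fourier coefficient at \<open>-q\<close>; it
  belongs to the same value \<open>m\<close> of the form.\<close>

lemma fourier_coefficient_eq_0:
  fixes A :: "real ^ 'n ^ 'n"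
  assumes A: "invertible A" and f: "smooth_fun f" "torus_periodic A f"
    and eig: "\<And>x. laplacian f x = complex_of_real l * f x"
    and q: "l \<noteq> 4 * pi\<^sup>2 * (int_vec q \<bullet> (inv_gram A *v int_vec q))"
  shows "integral (cbox 0 1) (\<lambda>y. f (A *v y) * torus_char A q (A *v y)) = 0"
proof -
  define g where "g = torus_char A q"
  define m where "m = 4 * pi\<^sup>2 * (int_vec q \<bullet> (inv_gram A *v int_vec q))"
  \<comment> \<open>Green's formula: the divergence of \<open>G\<close> integrates to 0.\<close>
  define G where "G i = (\<lambda>x. f x * partial_deriv i g x - g x * partial_deriv i f x)" for i
  have g: "smooth_fun g" "torus_periodic A g"
    by (simp_all add: g_def smooth_torus_char torus_char_periodic A)
  note fg = f(1) g(1) smooth_funD(2)[OF f(1)] smooth_funD(2)[OF g(1)]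
    smooth_funD(2)[OF smooth_funD(2)[OF f(1)]] smooth_funD(2)[OF smooth_funD(2)[OF g(1)]]
  note G = partial_deriv_diff_mult[OF f(1) g(1), folded G_def]
  have cont: "continuous_on UNIV (partial_deriv j (G i))" for i j
    unfolding G(2)[abs_def] by (intro continuous_intros smooth_fun_continuous fg)
  have per: "torus_periodic A (G i)" for i
    using f(2) g(2) partial_deriv_periodic[OF _ smooth_funD(1)[OF f(1)]]
      partial_deriv_periodic[OF _ smooth_funD(1)[OF g(1)]]
    by (simp add: torus_periodic_def G_def)
  have cA: "continuous_on (cbox 0 1) (\<lambda>y. h (A *v y))" if "continuous_on UNIV h" for h :: "real ^ 'n \<Rightarrow> complex"
    using linear_continuous_on matrix_vector_mul_bounded_linear that continuous_on_compose2 by blast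
  have "0 = (\<Sum>i\<in>UNIV. integral (cbox 0 1) (\<lambda>y. partial_deriv i (G i) (A *v y)))"
    by (simp add: integral_cube_partial_deriv[OF A per G(1) cont])
  also have "\<dots> = integral (cbox 0 1) (\<lambda>y. \<Sum>i\<in>UNIV. partial_deriv i (G i) (A *v y))"
    by (rule integral_sum[symmetric]) (auto intro!: integrable_continuous cA cont)
  also have "(\<lambda>y. \<Sum>i\<in>UNIV. partial_deriv i (G i) (A *v y))
      = (\<lambda>y. complex_of_real (l - m) * (f (A *v y) * g (A *v y)))"
  proof
    fix y
    have "(\<Sum>i\<in>UNIV. partial_deriv i (G i) (A *v y))
        = g (A *v y) * laplacian f (A *v y) - f (A *v y) * laplacian g (A *v y)"
      by (simp add: G(2) laplacian_def sum_subtractf sum_distrib_left sum_negf mult_ac)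
    then show "(\<Sum>i\<in>UNIV. partial_deriv i (G i) (A *v y)) = complex_of_real (l - m) * (f (A *v y) * g (A *v y))"
      by (simp add: eig laplacian_torus_char[OF A, of q, folded m_def g_def] algebra_simps)
  qed
  finally have "complex_of_real (l - m) * integral (cbox 0 1) (\<lambda>y. f (A *v y) * g (A *v y)) = 0" by simp
  moreover have "l \<noteq> m" using q by (simp add: m_def)
  ultimately show ?thesis by (simp add: g_def)
qed

section \<open>Density of the trigonometric polynomials\<close>

inductive_set trig_polys :: "(real ^ 'n \<Rightarrow> complex) set" where
  char: "(\<lambda>y. cis (2 * pi * (int_vec q \<bullet> y))) \<in> trig_polys"
| add: "f \<in> trig_polys \<Longrightarrow> g \<in> trig_polys \<Longrightarrow> (\<lambda>y. f y + g y) \<in> trig_polys"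
| scale: "f \<in> trig_polys \<Longrightarrow> (\<lambda>y. c * f y) \<in> trig_polys"

lemma trig_polys_const: "(\<lambda>y :: real ^ 'n. c) \<in> trig_polys"
proof -
  have "(\<lambda>y :: real ^ 'n. cis (2 * pi * (int_vec 0 \<bullet> y))) \<in> trig_polys" by (rule trig_polys.char)
  then have "(\<lambda>y :: real ^ 'n. 1) \<in> trig_polys"
    by (simp add: int_vec_def inner_vec_def)
  from trig_polys.scale[OF this, of c] show ?thesis by simp
qed

lemma trig_polys_sum: "(\<And>i. i \<in> I \<Longrightarrow> f i \<in> trig_polys) \<Longrightarrow> (\<lambda>y. \<Sum>i\<in>I. f i y) \<in> trig_polys"
  by (induction I rule: infinite_finite_induct) (auto intro: trig_polys_const trig_polys.add)

lemma trig_polys_mult: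
  assumes "f \<in> trig_polys" "g \<in> trig_polys"
  shows "(\<lambda>y. f y * g y) \<in> trig_polys"
  using assms(1)
proof induction
  case (char q)
  show ?case using assms(2)
  proof induction
    case (char q')
    have "int_vec q \<bullet> y + int_vec q' \<bullet> y = int_vec (q + q') \<bullet> y" for y
      by (simp add: int_vec_def inner_vec_def algebra_simps sum.distrib)
    then have "(\<lambda>y. cis (2 * pi * (int_vec q \<bullet> y)) * cis (2 * pi * (int_vec q' \<bullet> y)))
        = (\<lambda>y. cis (2 * pi * (int_vec (q + q') \<bullet> y)))"
      by (simp add: cis_mult flip: distrib_left)
    then show ?case using trig_polys.char by simp
  qed (auto simp: distrib_left mult.left_commute intro: trig_polys.add trig_polys.scale)
qed (auto simp: distrib_right mult.assoc intro: trig_polys.add trig_polys.scale)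

lemma trig_polys_continuous: "f \<in> trig_polys \<Longrightarrow> continuous_on S f"
  by (induction rule: trig_polys.induct) (auto intro!: continuous_intros)

text \<open>The standard torus embedded as a product of unit circles: a compact set to which the
  Stone-Weierstrass theorem for polynomials applies.\<close>

definition cis_vec :: "real ^ 'n \<Rightarrow> complex ^ 'n" where
  "cis_vec y = (\<chi> i. cis (2 * pi * y $ i))"

lemma continuous_cis_vec: "continuous_on S cis_vec"
  unfolding cis_vec_def by (intro continuous_intros)

text \<open>Sums and products stay in the algebra \<open>trig_polys\<close>, so only real-linear
  functionals need work. These are determined by their values at \<open>axis i 1\<close> and
  \<open>axis i \<i>\<close>, which are weighted by cosines and sines of the coordinates.\<close>

lemma real_polynomial_function_cis_vec:
  fixes h :: "complex ^ 'n \<Rightarrow> real"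
  assumes "real_polynomial_function h"
  shows "(\<lambda>y. complex_of_real (h (cis_vec y))) \<in> trig_polys"
  using assms
proof induction
  case (linear h)
  then interpret bounded_linear h .
  have exp: "z = (\<Sum>i\<in>UNIV. Re (z $ i) *\<^sub>R axis i 1 + Im (z $ i) *\<^sub>R axis i \<i>)" for z :: "complex ^ 'n"
  proof -
    have "Re (z $ i) *\<^sub>R axis i 1 + Im (z $ i) *\<^sub>R axis i \<i> = z $ i *s axis i 1" for i
      by (simp add: vec_eq_iff axis_def complex_eq_iff)
    then show ?thesis by (simp add: basis_expansion)
  qed
  \<comment> \<open>Euler's formulas for cosine and sine in the characters of the two vectors
    \<open>axis i 1\<close> and \<open>axis i (-1)\<close>; the difference is written with a factor
    \<open>-1\<close> to fit the closure rules of \<open>trig_polys\<close>.\<close>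
  have eq: "complex_of_real (h (cis_vec y))
      = (\<Sum>i\<in>UNIV. complex_of_real (h (axis i 1) / 2) * (cis (2 * pi * (int_vec (axis i 1) \<bullet> y)) + cis (2 * pi * (int_vec (axis i (-1)) \<bullet> y)))
        + (- \<i> * complex_of_real (h (axis i \<i>) / 2)) * (cis (2 * pi * (int_vec (axis i 1) \<bullet> y)) + (-1) * cis (2 * pi * (int_vec (axis i (-1)) \<bullet> y))))"
    for y
  proof -
    have int: "int_vec (axis i 1) \<bullet> y = y $ i" "int_vec (axis i (- 1)) \<bullet> y = - y $ i" for i
    proof -
      have "int_vec (axis i (- 1)) = - axis i (1 :: real)"
        by (simp add: int_vec_def axis_def vec_eq_iff)
      then show "int_vec (axis i 1) \<bullet> y = y $ i" "int_vec (axis i (- 1)) \<bullet> y = - y $ i"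
        by (simp_all add: int_vec_axis inner_axis')
    qed
    have "h (cis_vec y) = (\<Sum>i\<in>UNIV. cos (2 * pi * y $ i) * h (axis i 1) + sin (2 * pi * y $ i) * h (axis i \<i>))"
      by (subst exp) (simp add: sum add scaleR cis_vec_def)
    then show ?thesis
      by (simp only: int of_real_sum) (intro sum.cong refl, simp add: complex_eq_iff)
  qed
  show ?case unfolding eq
    by (intro trig_polys_sum trig_polys.intros)
qed (auto intro: trig_polys_const trig_polys.add trig_polys_mult)

lemma periodic_eq_frac:
  fixes F :: "real ^ 'n \<Rightarrow> 'b"
  assumes "\<And>y k. F (y + int_vec k) = F y"
  shows "F y = F (\<chi> i. frac (y $ i))"
proof -
  have "y = (\<chi> i. frac (y $ i)) + int_vec (\<chi> i. \<lfloor>y $ i\<rfloor>)"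
    by (simp add: vec_eq_iff int_vec_def frac_def)
  then show ?thesis using assms by metis
qed

lemma cis_vec_eq_iff: "cis_vec y = cis_vec z \<longleftrightarrow> (\<exists>k. y = z + int_vec k)"
proof
  assume "cis_vec y = cis_vec z"
  then have "\<forall>i. \<exists>k. y $ i = z $ i + real_of_int k"
  proof (intro allI)
    fix i
    have "cis (2 * pi * y $ i) = cis (2 * pi * z $ i)"
      using \<open>cis_vec y = cis_vec z\<close> by (simp add: cis_vec_def vec_eq_iff)
    then have "sin (2 * pi * y $ i) = sin (2 * pi * z $ i) \<and> cos (2 * pi * y $ i) = cos (2 * pi * z $ i)"
      by (simp add: complex_eq_iff)
    then obtain n where "2 * pi * y $ i = 2 * pi * z $ i + 2 * pi * real_of_int n"
      using sin_cos_eq_iff by blast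
    then have "y $ i = z $ i + real_of_int n" by (simp flip: distrib_left)
    then show "\<exists>k. y $ i = z $ i + real_of_int k" by blast
  qed
  then obtain k where "\<forall>i. y $ i = z $ i + real_of_int (k i)" by metis
  then have "y = z + int_vec (\<chi> i. k i)" by (simp add: vec_eq_iff int_vec_def)
  then show "\<exists>k. y = z + int_vec k" by blast
next
  assume "\<exists>k. y = z + int_vec k"
  then show "cis_vec y = cis_vec z"
    by (auto simp: cis_vec_def vec_eq_iff int_vec_def distrib_left simp flip: cis_mult)
qed

text \<open>A real polynomial approximates the function induced on the compact torus
  \<open>T\<close> uniformly; pulled back along \<open>cis_vec\<close> it is a trigonometric
  polynomial.\<close>

lemma trig_polys_dense:
  fixes F :: "real ^ 'n \<Rightarrow> real"
  assumes cont: "continuous_on UNIV F" and per: "\<And>y k. F (y + int_vec k) = F y" and "0 < \<epsilon>"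
  obtains p where "p \<in> trig_polys" "\<And>y. cmod (complex_of_real (F y) - p y) < \<epsilon>"
proof -
  define T where "T = cis_vec ` cbox 0 (1 :: real ^ 'n)"
  have "compact T"
    unfolding T_def by (intro compact_continuous_image continuous_cis_vec compact_cbox)
  have T: "cis_vec y \<in> T" for y :: "real ^ 'n"
  proof -
    have "cis_vec y = cis_vec (\<chi> i. frac (y $ i))"
      by (rule periodic_eq_frac) (metis cis_vec_eq_iff)
    moreover have "(\<chi> i. frac (y $ i)) \<in> cbox 0 1"
      by (simp add: mem_box_cart frac_ge_0 less_imp_le[OF frac_lt_1])
    ultimately show ?thesis unfolding T_def by (metis imageI)
  qed
  \<comment> \<open>\<open>F\<close> descends to a continuous function on the torus because \<open>cis_vec\<close> is a closed map on the cube.\<close>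
  define F' where "F' z = F (SOME y. cis_vec y = z)" for z
  have F': "F' (cis_vec y) = F y" for y
  proof -
    have "cis_vec (SOME y'. cis_vec y' = cis_vec y) = cis_vec y" by (rule someI) simp
    then show ?thesis unfolding F'_def cis_vec_eq_iff using per by metis
  qed
  have "continuous_on T F'"
    unfolding continuous_on_closed_vimage[OF compact_imp_closed[OF \<open>compact T\<close>]]
  proof (intro allI impI)
    fix B :: "real set" assume "closed B"
    have "F' -` B \<inter> T = cis_vec ` (cbox 0 1 \<inter> F -` B)"
      by (auto simp: T_def F')
    moreover have "closed (F -` B)"
      using cont \<open>closed B\<close> continuous_closed_vimage continuous_on_eq_continuous_at open_UNIV by blast
    then have "compact (cis_vec ` (cbox 0 1 \<inter> F -` B))"
      by (intro compact_continuous_image continuous_cis_vec compact_Int_closed compact_cbox)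
    ultimately show "closed (F' -` B \<inter> T)" by (simp add: compact_imp_closed)
  qed
  then obtain g where g: "polynomial_function g" "\<forall>z\<in>T. norm (F' z - g z) < \<epsilon>"
    using Stone_Weierstrass_polynomial_function[OF \<open>compact T\<close>] \<open>0 < \<epsilon>\<close> by blast
  show ?thesis
  proof (rule that[OF real_polynomial_function_cis_vec])
    show "real_polynomial_function g" using g(1) real_polynomial_function_eq by blast
    show "cmod (complex_of_real (F y) - complex_of_real (g (cis_vec y))) < \<epsilon>" for y
    proof -
      have "\<bar>F y - g (cis_vec y)\<bar> < \<epsilon>" using g(2) T[of y] F'[of y] by fastforce
      then show ?thesis by (metis norm_of_real of_real_diff)
    qed
  qed
qed

section \<open>Uniqueness of Fourier coefficients and the exact spectrum\<close>

lemma integral_cube_trig_poly_eq_0: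
  fixes F :: "real ^ 'n \<Rightarrow> complex"
  assumes cont: "continuous_on UNIV F"
    and coeff: "\<And>q. integral (cbox 0 1) (\<lambda>y. F y * cis (2 * pi * (int_vec q \<bullet> y))) = 0"
    and "p \<in> trig_polys"
  shows "integral (cbox 0 1) (\<lambda>y. F y * p y) = 0"
  using assms(3)
proof induction
  case (char q)
  show ?case by (rule coeff)
next
  case (add f g)
  have "(\<lambda>y. F y * h y) integrable_on cbox 0 1" if "h \<in> trig_polys" for h
    by (intro integrable_continuous continuous_intros trig_polys_continuous that continuous_on_subset[OF cont]) auto
  then show ?case using add by (simp add: distrib_left integral_add)
next
  case (scale f c)
  then show ?case by (simp add: mult.left_commute[of _ c])
qed

text \<open>\<open>R\<close> is replaced by a trigonometric polynomial, against which
  \<open>F\<close> integrates to 0. With \<open>B\<close> a bound for \<open>F\<close>, the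
  tolerance \<open>\<epsilon> / B\<close> costs at most \<open>\<epsilon>\<close>, as the cube has
  volume 1.\<close>

lemma integral_cube_periodic_eq_0:
  fixes F :: "real ^ 'n \<Rightarrow> complex" and R :: "real ^ 'n \<Rightarrow> real"
  assumes F: "continuous_on UNIV F"
    and R: "continuous_on UNIV R" "\<And>y k. R (y + int_vec k) = R y"
    and coeff: "\<And>q. integral (cbox 0 1) (\<lambda>y. F y * cis (2 * pi * (int_vec q \<bullet> y))) = 0"
  shows "integral (cbox 0 1) (\<lambda>y. F y * complex_of_real (R y)) = 0"
proof -
  have "compact (F ` cbox 0 1)"
    by (intro compact_continuous_image compact_cbox continuous_on_subset[OF F]) auto
  then obtain B where "0 < B" and B: "\<And>y. y \<in> cbox 0 1 \<Longrightarrow> cmod (F y) \<le> B"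
    by (metis bounded_pos compact_imp_bounded imageI)
  let ?I = "integral (cbox 0 1) (\<lambda>y. F y * complex_of_real (R y))"
  have "cmod ?I \<le> \<epsilon>" if "0 < \<epsilon>" for \<epsilon>
  proof -
    obtain p where p: "p \<in> trig_polys" "\<And>y. cmod (complex_of_real (R y) - p y) < \<epsilon> / B"
      using trig_polys_dense[OF R, of "\<epsilon> / B"] \<open>0 < \<epsilon>\<close> \<open>0 < B\<close> by auto
    have int: "(\<lambda>y. F y * h y) integrable_on cbox 0 1" if "continuous_on UNIV h" for h
      by (intro integrable_continuous continuous_intros continuous_on_subset[OF F] continuous_on_subset[OF that]) auto
    have c: "continuous_on UNIV (\<lambda>y. complex_of_real (R y))" "continuous_on UNIV p"
      using R(1) p(1) by (auto intro!: continuous_intros trig_polys_continuous)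
    have "?I = ?I - integral (cbox 0 1) (\<lambda>y. F y * p y)"
      using integral_cube_trig_poly_eq_0[OF F coeff p(1)] by simp
    also have "\<dots> = integral (cbox 0 1) (\<lambda>y. F y * (complex_of_real (R y) - p y))"
      using int[OF c(1)] int[OF c(2)] by (simp add: right_diff_distrib integral_diff)
    also have "cmod \<dots> \<le> integral (cbox 0 (1 :: real ^ 'n)) (\<lambda>y. \<epsilon>)"
    proof (rule Henstock_Kurzweil_Integration.integral_norm_bound_integral)
      show "(\<lambda>y. F y * (complex_of_real (R y) - p y)) integrable_on cbox 0 1"
        by (intro int continuous_intros c)
      fix y :: "real ^ 'n" assume y: "y \<in> cbox 0 1"
      have "cmod (F y) * cmod (complex_of_real (R y) - p y) \<le> B * (\<epsilon> / B)"
        using B[OF y] p(2)[of y] \<open>0 < B\<close> by (intro mult_mono) auto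
      then show "cmod (F y * (complex_of_real (R y) - p y)) \<le> \<epsilon>"
        using \<open>0 < B\<close> by (simp add: norm_mult)
    qed (rule integrable_const)
    also have "\<dots> = \<epsilon>"
    proof -
      have "(0 :: real ^ 'n) \<in> cbox 0 1" by (simp add: mem_box_cart)
      then have "measure lborel (cbox 0 (1 :: real ^ 'n)) = 1"
        by (auto simp: content_cbox_if_cart)
      then show ?thesis by simp
    qed
    finally show ?thesis by simp
  qed
  then show ?thesis
    using field_le_epsilon[of "cmod ?I" 0] by simp
qed

text \<open>Testing \<open>F\<close> against its own real and imaginary parts shows that the squared
  modulus integrates to 0. By continuity \<open>F\<close> vanishes on the cube, hence everywhere by
  periodicity.\<close>

lemma periodic_eq_0I:
  fixes F :: "real ^ 'n \<Rightarrow> complex"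
  assumes cont: "continuous_on UNIV F" and per: "\<And>y k. F (y + int_vec k) = F y"
    and coeff: "\<And>q. integral (cbox 0 1) (\<lambda>y. F y * cis (2 * pi * (int_vec q \<bullet> y))) = 0"
  shows "F y = 0"
proof -
  have c: "continuous_on UNIV (\<lambda>y. Re (F y))" "continuous_on UNIV (\<lambda>y. Im (F y))"
    by (intro continuous_intros cont)+
  have int: "h integrable_on cbox 0 1" if "continuous_on UNIV h" for h :: "real ^ 'n \<Rightarrow> complex"
    by (intro integrable_continuous continuous_on_subset[OF that]) auto
  have "integral (cbox 0 1) (\<lambda>y. F y * complex_of_real (Re (F y))) = 0"
    by (rule integral_cube_periodic_eq_0[OF cont c(1) _ coeff]) (simp add: per)
  moreover have "integral (cbox 0 1) (\<lambda>y. F y * complex_of_real (Im (F y))) = 0"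
    by (rule integral_cube_periodic_eq_0[OF cont c(2) _ coeff]) (simp add: per)
  ultimately have "integral (cbox 0 1) (\<lambda>y. F y * complex_of_real (Re (F y)) - \<i> * (F y * complex_of_real (Im (F y)))) = 0"
    by (subst integral_diff) (auto intro!: int continuous_intros cont)
  moreover have "(\<lambda>y. F y * complex_of_real (Re (F y)) - \<i> * (F y * complex_of_real (Im (F y))))
      = (\<lambda>y. complex_of_real ((cmod (F y))\<^sup>2))"
    unfolding cmod_power2 by (simp add: fun_eq_iff complex_eq_iff power2_eq_square algebra_simps)
  ultimately have "integral (cbox 0 1) (\<lambda>y. complex_of_real ((cmod (F y))\<^sup>2)) = 0" by (simp only:)
  moreover have cont2: "continuous_on (cbox 0 1) (\<lambda>y. (cmod (F y))\<^sup>2)"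
    by (intro continuous_intros continuous_on_subset[OF cont]) auto
  then have "integral (cbox 0 1) (complex_of_real \<circ> (\<lambda>y. (cmod (F y))\<^sup>2))
      = complex_of_real (integral (cbox 0 1) (\<lambda>y. (cmod (F y))\<^sup>2))"
    by (intro integral_linear bounded_linear_of_real integrable_continuous)
  ultimately have "integral (cbox 0 1) (\<lambda>y. (cmod (F y))\<^sup>2) = 0"
    unfolding o_def by (metis of_real_eq_0_iff)
  moreover have "box 0 (1 :: real ^ 'n) \<noteq> {}"
    by (auto simp: box_ne_empty inner_vec_def Basis_vec_def axis_def if_distrib cong: if_cong)
  ultimately have "\<forall>y\<in>cbox 0 1. (cmod (F y))\<^sup>2 = 0"
    using integral_cbox_eq_0_iff[OF cont2] by simp
  moreover have "(\<chi> i. frac (y $ i)) \<in> cbox 0 1"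
    by (simp add: mem_box_cart frac_ge_0 less_imp_le[OF frac_lt_1])
  ultimately show ?thesis
    using periodic_eq_frac[of F y] per by simp
qed

text \<open>An eigenfunction for any other \<open>l\<close> would have only zero Fourier
  coefficients and thus vanish identically. Conversely the characters are eigenfunctions.\<close>

theorem torus_eigenvalue_iff:
  fixes A :: "real ^ 'n ^ 'n"
  assumes A: "invertible A"
  shows "torus_eigenvalue A l \<longleftrightarrow> (\<exists>q. l = 4 * pi\<^sup>2 * (int_vec q \<bullet> (inv_gram A *v int_vec q)))"
proof
  assume "\<exists>q. l = 4 * pi\<^sup>2 * (int_vec q \<bullet> (inv_gram A *v int_vec q))"
  then obtain q where "l = 4 * pi\<^sup>2 * (int_vec q \<bullet> (inv_gram A *v int_vec q))" ..
  moreover have "torus_char A q 0 \<noteq> 0" by (simp add: torus_char_eq)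
  ultimately show "torus_eigenvalue A l"
    unfolding torus_eigenvalue_def
    using smooth_torus_char torus_char_periodic[OF A] laplacian_torus_char[OF A] by blast
next
  assume "torus_eigenvalue A l"
  then obtain f x where f: "smooth_fun f" "torus_periodic A f" "f x \<noteq> 0"
      "\<And>x. laplacian f x = complex_of_real l * f x"
    unfolding torus_eigenvalue_def by blast
  show "\<exists>q. l = 4 * pi\<^sup>2 * (int_vec q \<bullet> (inv_gram A *v int_vec q))"
  proof (rule ccontr)
    assume no: "\<nexists>q. l = 4 * pi\<^sup>2 * (int_vec q \<bullet> (inv_gram A *v int_vec q))"
    have "torus_char A q (A *v y) = cis (2 * pi * (int_vec q \<bullet> y))" for q y
      using matrix_inv_left[OF A]
      by (simp add: torus_char_eq dot_lmul_matrix matrix_vector_mul_assoc)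
    then have coeff: "integral (cbox 0 1) (\<lambda>y. f (A *v y) * cis (2 * pi * (int_vec q \<bullet> y))) = 0" for q
      using fourier_coefficient_eq_0[OF A f(1,2,4), of q] no by auto
    have "f (A *v (matrix_inv A *v x)) = 0"
    proof (rule periodic_eq_0I[where F = "\<lambda>y. f (A *v y)", OF _ _ coeff])
      show "continuous_on UNIV (\<lambda>y. f (A *v y))"
        using smooth_fun_continuous[OF f(1)] linear_continuous_on matrix_vector_mul_bounded_linear
          continuous_on_compose2 by blast
      show "f (A *v (y + int_vec k)) = f (A *v y)" for y k
        using f(2) by (simp add: torus_periodic_def matrix_vector_right_distrib)
    qed
    then show False
      using f(3) matrix_inv_right[OF A] by (simp add: matrix_vector_mul_assoc)
  qed
qed

section \<open>Nodal counts\<close>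

definition l1_norm :: "int ^ 'n \<Rightarrow> int" where
  "l1_norm q = (\<Sum>i\<in>UNIV. \<bar>q $ i\<bar>)"

section \<open>Components cut out by parallel hyperplanes\<close>

text \<open>The complement of a piece is the union of the others, hence open, so every piece is
  clopen in \<open>S\<close>. A connected set meeting a clopen piece lies inside it.\<close>

lemma components_eq_partition:
  assumes disj: "pairwise disjnt F" and un: "\<Union>F = S"
    and F: "\<And>X. X \<in> F \<Longrightarrow> openin (top_of_set S) X \<and> connected X \<and> X \<noteq> {}"
  shows "components S = F"
proof -
  have comp: "connected_component_set S x = X" if "X \<in> F" "x \<in> X" for X x
  proof -
    define C where "C = connected_component_set S x"
    have "X \<subseteq> C"
      unfolding C_def using that F un by (intro connected_component_maximal) auto
    have "S - X = \<Union>(F - {X})"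
      using disj un that by (auto simp: pairwise_def disjnt_def)
    then have "openin (top_of_set S) (S - X)"
      using F by (metis DiffE openin_Union)
    then have "closedin (top_of_set S) X"
      using that un by (auto simp: closedin_def)
    moreover have "openin (top_of_set S) X" using F that by auto
    ultimately obtain T T' where T: "open T" "X = S \<inter> T" "closed T'" "X = S \<inter> T'"
      by (auto simp: openin_open closedin_closed)
    have "C \<inter> X = C \<inter> T" "C \<inter> X = C \<inter> T'"
      using T(2,4) connected_component_subset[of S x] by (auto simp: C_def)
    then have "openin (top_of_set C) (C \<inter> X)" "closedin (top_of_set C) (C \<inter> X)"
      using T(1,3) by (auto simp: openin_open closedin_closed)
    moreover have "connected C" "x \<in> C"
      using that un by (auto simp: C_def)
    ultimately have "C \<inter> X = C" using that by (metis IntI connected_clopen empty_iff)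
    with \<open>X \<subseteq> C\<close> show ?thesis by (auto simp: C_def)
  qed
  show ?thesis
  proof
    show "components S \<subseteq> F"
      using comp un by (force simp: components_def)
    show "F \<subseteq> components S"
    proof
      fix X assume X: "X \<in> F"
      then obtain x where "x \<in> X" using F by blast
      then show "X \<in> components S" using comp[OF X] X un by (metis UnionI componentsI)
    qed
  qed
qed

lemma sin_pi_eq_0_iff: "sin (pi * t) = 0 \<longleftrightarrow> t \<in> \<int>"
  by (metis Ints_cases Ints_of_int mult.commute mult_cancel_right pi_neq_zero sin_zero_iff_int2)

text \<open>The components are the slices \<open>J k\<close> of \<open>K\<close> between consecutive
  integer levels of the affine function. Each is convex, hence connected, and it is nonempty exactly
  when the open interval from \<open>k\<close> to \<open>k + 1\<close> meets
  \<open>{m..M}\<close>.\<close>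

lemma card_components_sin:
  fixes u :: "'a :: euclidean_space" and c m M :: real
  assumes K: "convex K" and img: "(\<lambda>y. u \<bullet> y + c) ` K = {m..M}" and "m \<le> M"
  shows "card (components {y \<in> K. sin (pi * (u \<bullet> y + c)) \<noteq> 0})
       = card {k :: int. m - 1 < k \<and> k < M}"
proof -
  define g where "g y = u \<bullet> y + c" for y
  define S where "S = {y \<in> K. sin (pi * g y) \<noteq> 0}"
  define J where "J k = {y \<in> K. real_of_int k < g y \<and> g y < real_of_int k + 1}" for k :: int
  define I where "I = {k :: int. m - 1 < k \<and> k < M}"
  have floorJ: "y \<in> J k \<longleftrightarrow> y \<in> S \<and> \<lfloor>g y\<rfloor> = k" for y k
  proof -
    have "g y \<notin> \<int>" if "real_of_int k < g y" "g y < real_of_int k + 1"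
      using that by (metis Ints_cases floor_of_int floor_unique less_irrefl less_imp_le)
    moreover have "real_of_int \<lfloor>g y\<rfloor> < g y" if "g y \<notin> \<int>"
      using that by (metis Ints_of_int of_int_floor_le order_less_le)
    ultimately show ?thesis
      unfolding J_def S_def sin_pi_eq_0_iff mem_Collect_eq
      by (metis floor_unique less_imp_le real_of_int_floor_add_one_gt)
  qed
  have ne: "J k \<noteq> {} \<longleftrightarrow> k \<in> I" for k
  proof
    assume "J k \<noteq> {}"
    then obtain y where y: "y \<in> K" "k < g y" "g y < k + 1" by (auto simp: J_def)
    then have "g y \<in> {m..M}" using img by (auto simp: g_def)
    with y show "k \<in> I" by (auto simp: I_def)
  next
    assume "k \<in> I"
    \<comment> \<open>The midpoint of the overlap of \<open>{m..M}\<close> with the interval from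
      \<open>k\<close> to \<open>k + 1\<close>.\<close>
    define t where "t = (max m k + min M (k + 1)) / 2"
    have t: "t \<in> {m..M}" "k < t" "t < k + 1" using \<open>k \<in> I\<close> \<open>m \<le> M\<close>
      by (auto simp: I_def t_def max_def min_def)
    then obtain y where "y \<in> K" "t = g y" using img by (force simp: g_def)
    with t show "J k \<noteq> {}" by (auto simp: J_def)
  qed
  have "components S = J ` I"
  proof (rule components_eq_partition)
    show "pairwise disjnt (J ` I)"
      by (auto simp: pairwise_def disjnt_def floorJ)
    show "\<Union> (J ` I) = S"
      using floorJ ne by blast
    fix X assume "X \<in> J ` I"
    then obtain k where k: "X = J k" "k \<in> I" by blast
    have "J k = S \<inter> {y. k < g y \<and> g y < k + 1}"
      using floorJ by (auto simp: J_def S_def)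
    moreover have "open {y. k < g y \<and> g y < k + 1}"
      unfolding g_def by (intro open_Collect_conj open_Collect_less continuous_intros)
    ultimately have "openin (top_of_set S) (J k)" by auto
    moreover have "J k = K \<inter> {y. u \<bullet> y > k - c} \<inter> {y. u \<bullet> y < k + 1 - c}"
      by (auto simp: J_def g_def)
    then have "connected (J k)"
      using K by (auto intro!: convex_connected convex_Int convex_halfspace_gt convex_halfspace_lt)
    ultimately show "openin (top_of_set S) X \<and> connected X \<and> X \<noteq> {}"
      using k ne by auto
  qed
  moreover have "inj_on J I"
    by (rule inj_onI) (metis floorJ ne ex_in_conv)
  ultimately show ?thesis
    by (simp add: card_image S_def g_def I_def)
qed

lemma int_vec_image_cube:
  fixes q :: "int ^ 'n"
  shows "(\<lambda>y. int_vec q \<bullet> y) ` cbox 0 1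
       = {real_of_int (\<Sum>i\<in>UNIV. min (q $ i) 0) .. real_of_int (\<Sum>i\<in>UNIV. max (q $ i) 0)}"
    (is "?g ` _ = {?m..?M}")
proof
  show "?g ` cbox 0 1 \<subseteq> {?m..?M}"
  proof (rule image_subsetI)
    fix y :: "real ^ 'n" assume "y \<in> cbox 0 1"
    then have y: "0 \<le> y $ i" "y $ i \<le> 1" for i by (auto simp: mem_box_cart)
    have bounds: "min x 0 \<le> x * y $ i" "x * y $ i \<le> max x 0" for x i
    proof -
      have "x * y $ i \<le> x \<and> 0 \<le> x * y $ i" if "0 \<le> x"
        using that y[of i] by (simp add: mult_left_le)
      moreover have "x \<le> x * y $ i \<and> x * y $ i \<le> 0" if "x \<le> 0"
        using that y[of i] mult_left_mono_neg[of "y $ i" 1 x] by (simp add: mult_le_0_iff)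
      ultimately show "min x 0 \<le> x * y $ i" "x * y $ i \<le> max x 0"
        by (cases "0 \<le> x"; simp)+
    qed
    then show "?g y \<in> {?m..?M}"
      by (auto simp: inner_vec_def int_vec_def of_int_min of_int_max intro!: sum_mono bounds)
  qed
  \<comment> \<open>The vertices of the cube where the functional attains its minimum and maximum;
    connectedness gives all values in between.\<close>
  define lo hi :: "real ^ 'n"
    where "lo = (\<chi> i. if q $ i < 0 then 1 else 0)" and "hi = (\<chi> i. if q $ i < 0 then 0 else 1)"
  have b: "lo \<in> cbox 0 1" "hi \<in> cbox 0 1" by (auto simp: mem_box_cart lo_def hi_def)
  have v: "?g lo = ?m" "?g hi = ?M"
    by (auto simp: inner_vec_def int_vec_def lo_def hi_def intro!: sum.cong)
  have "connected (?g ` cbox 0 1)"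
    by (intro connected_continuous_image continuous_intros convex_connected convex_box)
  then show "{?m..?M} \<subseteq> ?g ` cbox 0 1"
    using b v by (metis connected_contains_Icc imageI)
qed

lemma card_int_interval: "card {k :: int. l - 1 < k \<and> k < h} = nat (h - l)"
proof -
  have "{k :: int. l - 1 < k \<and> k < h} = {l..<h}" by auto
  then show ?thesis by simp
qed

text \<open>Both parts of the character are \<open>sin (pi * g y)\<close> with \<open>g\<close>
  affine, of slope vector \<open>2 *\<^sub>R int_vec q\<close> and constant term 0 for
  \<open>Im\<close>, 1/2 for \<open>Re\<close>. On the cube \<open>g\<close> sweeps an interval
  whose length is twice the \<open>\<ell>\<close>1-norm of \<open>q\<close>.\<close>

lemma nodal_count_eq:
  fixes A :: "real ^ 'n ^ 'n"
  assumes "invertible A" "P = Re \<or> P = Im"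
  shows "nodal_count P A q = 2 * nat (l1_norm q) + (if P = Re then 1 else 0)"
proof -
  define m M where "m = (\<Sum>i\<in>UNIV. min (q $ i) 0)" and "M = (\<Sum>i\<in>UNIV. max (q $ i) 0)"
  have "m \<le> M" unfolding m_def M_def by (intro sum_mono) auto
  have l1: "l1_norm q = M - m"
    unfolding l1_norm_def m_def M_def sum_subtractf[symmetric] by (intro sum.cong) auto
  have inv: "matrix_inv A *v (A *v y) = y" for y
    by (simp add: assms(1) matrix_inv_left matrix_vector_mul_assoc)
  have char: "torus_char A q (A *v y) = cis (2 * pi * (int_vec q \<bullet> y))" for y
  proof -
    have "(\<Sum>j\<in>UNIV. real_of_int (q $ j) * (matrix_inv A *v (A *v y)) $ j) = int_vec q \<bullet> y"
      unfolding inv by (simp add: inner_vec_def int_vec_def)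
    then show ?thesis by (simp add: torus_char_def cis_conv_exp mult_ac)
  qed
  have img: "(\<lambda>y. (2 *\<^sub>R int_vec q) \<bullet> y + e) ` cbox 0 1 = {2 * real_of_int m + e .. 2 * real_of_int M + e}" for e
  proof -
    have "(\<lambda>y. (2 *\<^sub>R int_vec q) \<bullet> y + e) ` cbox 0 1 = (\<lambda>t. 2 * t + e) ` (\<lambda>y. int_vec q \<bullet> y) ` cbox 0 1"
      by (simp add: image_image)
    also have "\<dots> = {2 * real_of_int m + e .. 2 * real_of_int M + e}"
      unfolding int_vec_image_cube m_def[symmetric] M_def[symmetric]
      using \<open>m \<le> M\<close> image_affinity_atLeastAtMost[of 2 e "real_of_int m" "real_of_int M"] by simp
    finally show ?thesis .
  qed
  have count: "card (components {y \<in> cbox 0 1. sin (pi * ((2 *\<^sub>R int_vec q) \<bullet> y + e)) \<noteq> 0})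
       = card {k :: int. 2 * real_of_int m + e - 1 < k \<and> k < 2 * real_of_int M + e}" for e
    by (rule card_components_sin[OF convex_box(1) img]) (use \<open>m \<le> M\<close> in simp)
  show ?thesis
  proof (cases "P = Re")
    case True
    have "{y \<in> cbox 0 1. P (torus_char A q (A *v y)) \<noteq> 0}
        = {y \<in> cbox 0 1. sin (pi * ((2 *\<^sub>R int_vec q) \<bullet> y + 1 / 2)) \<noteq> 0}"
    proof -
      have "cos (2 * pi * t) = sin (pi * (2 * t + 1 / 2))" for t
        by (simp add: sin_add distrib_left mult_ac)
      then show ?thesis by (simp add: char True)
    qed
    \<comment> \<open>The shift by 1/2 admits the additional level \<open>k = 2 * M\<close>, which
      is the extra nodal domain of the real part.\<close>
    moreover have "{k :: int. 2 * real_of_int m + 1/2 - 1 < k \<and> k < 2 * real_of_int M + 1/2}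
      = {k. 2 * m - 1 < k \<and> k < 2 * M + 1}"
      by (auto; linarith)
    ultimately show ?thesis
      using count[of "1/2"] card_int_interval[of "2 * m" "2 * M + 1"] True \<open>m \<le> M\<close>
      by (simp add: nodal_count_def l1)
  next
    case False
    then have "P = Im" "P \<noteq> Re" using assms by auto
    then have "{y \<in> cbox 0 1. P (torus_char A q (A *v y)) \<noteq> 0}
        = {y \<in> cbox 0 1. sin (pi * ((2 *\<^sub>R int_vec q) \<bullet> y + 0)) \<noteq> 0}"
      by (simp add: char mult_ac)
    moreover have "{k :: int. 2 * real_of_int m + 0 - 1 < k \<and> k < 2 * real_of_int M + 0}
      = {k. 2 * m - 1 < k \<and> k < 2 * M}"
      by (auto; linarith)
    ultimately show ?thesis
      using count[of 0] card_int_interval[of "2 * m" "2 * M"] \<open>P \<noteq> Re\<close> \<open>m \<le> M\<close>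
      by (simp add: nodal_count_def l1)
  qed
qed

section \<open>Nodal sequences and the dual form\<close>

definition dual_form :: "real ^ 'n ^ 'n \<Rightarrow> int ^ 'n \<Rightarrow> real" where
  "dual_form A q = int_vec q \<bullet> (inv_gram A *v int_vec q)"

section \<open>Discreteness and enumeration of the spectrum\<close>

lemma dual_form_eq_norm:
  fixes A :: "real ^ 'n ^ 'n"
  assumes "invertible A"
  shows "dual_form A q = (norm (transpose (matrix_inv A) *v int_vec q))\<^sup>2"
  by (simp add: dual_form_def inv_gram_eq[OF assms] dot_lmul_matrix power2_norm_eq_inner
      flip: matrix_vector_mul_assoc)

lemma dual_form_nonneg: "invertible A \<Longrightarrow> 0 \<le> dual_form A q"
  by (simp add: dual_form_eq_norm)

lemma int_vec_eq_transpose_mult: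
  fixes A :: "real ^ 'n ^ 'n"
  assumes "invertible A"
  shows "int_vec q = transpose A *v (transpose (matrix_inv A) *v int_vec q)"
proof -
  have "transpose A ** transpose (matrix_inv A) = transpose (matrix_inv A ** A)"
    by (simp add: matrix_transpose_mul)
  also have "\<dots> = mat 1" by (simp add: matrix_inv_left[OF assms])
  finally show ?thesis by (simp only: matrix_vector_mul_assoc matrix_vector_mul_lid)
qed

lemma dual_form_eq_0_iff:
  fixes A :: "real ^ 'n ^ 'n"
  assumes "invertible A"
  shows "dual_form A q = 0 \<longleftrightarrow> q = 0"
proof
  assume "dual_form A q = 0"
  then have "int_vec q = 0"
    using int_vec_eq_transpose_mult[OF assms, of q] by (simp add: dual_form_eq_norm[OF assms])
  then show "q = 0" by (simp add: int_vec_def vec_eq_iff)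
next
  assume "q = 0"
  moreover have "int_vec 0 = (0 :: real ^ 'n)" by (simp add: int_vec_def vec_eq_iff)
  ultimately show "dual_form A q = 0" by (simp add: dual_form_def)
qed

lemma finite_int_vec_norm_le: "finite {q :: int ^ 'n. norm (int_vec q) \<le> r}"
proof (rule finite_subset)
  let ?B = "{- \<lceil>r\<rceil>..\<lceil>r\<rceil>}"
  show "{q :: int ^ 'n. norm (int_vec q) \<le> r} \<subseteq> vec_lambda ` (UNIV \<rightarrow>\<^sub>E ?B)"
  proof
    fix q :: "int ^ 'n" assume "q \<in> {q. norm (int_vec q) \<le> r}"
    then have r: "norm (int_vec q) \<le> r" by simp
    have "\<bar>q $ i\<bar> \<le> \<lceil>r\<rceil>" for i
    proof -
      have "\<bar>int_vec q $ i\<bar> \<le> real_of_int \<lceil>r\<rceil>"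
        using component_le_norm_cart[of "int_vec q" i] r le_of_int_ceiling[of r] by linarith
      then have "real_of_int \<bar>q $ i\<bar> \<le> real_of_int \<lceil>r\<rceil>" by (simp add: int_vec_def)
      then show ?thesis by (simp only: of_int_le_iff)
    qed
    then have "q $ i \<in> ?B" for i
      by (simp add: abs_le_iff) (metis minus_le_iff)
    then have "vec_nth q \<in> UNIV \<rightarrow>\<^sub>E ?B" by auto
    then show "q \<in> vec_lambda ` (UNIV \<rightarrow>\<^sub>E ?B)"
      by (metis imageI vec_nth_inverse)
  qed
  show "finite (vec_lambda ` ((UNIV :: 'n set) \<rightarrow>\<^sub>E ?B))"
    by (intro finite_imageI finite_PiE) auto
qed

text \<open>The bounded map \<open>transpose A\<close> recovers \<open>q\<close> from a vector whose
  squared length is the dual form, so a bound on the form bounds \<open>q\<close>. This yields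
  finite multiplicities and a discrete spectrum.\<close>

lemma finite_dual_form_le:
  fixes A :: "real ^ 'n ^ 'n"
  assumes "invertible A"
  shows "finite {q. dual_form A q \<le> r}"
proof -
  obtain K where K: "0 < K" "\<And>x. norm (transpose A *v x) \<le> K * norm x"
    using bounded_linear.pos_bounded[OF matrix_vector_mul_bounded_linear[of "transpose A"]]
    by (metis mult.commute)
  have "{q. dual_form A q \<le> r} \<subseteq> {q. norm (int_vec q) \<le> K * sqrt r}"
  proof clarify
    fix q assume "dual_form A q \<le> r"
    then have "norm (transpose (matrix_inv A) *v int_vec q) \<le> sqrt r"
      using real_le_rsqrt by (simp add: dual_form_eq_norm[OF assms])
    then show "norm (int_vec q) \<le> K * sqrt r"
      using K(2)[of "transpose (matrix_inv A) *v int_vec q"] K(1) mult_left_mono[of "norm (transpose (matrix_inv A) *v int_vec q)" "sqrt r" K]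
      unfolding int_vec_eq_transpose_mult[OF assms, of q, symmetric] by linarith
  qed
  then show ?thesis by (rule finite_subset) (rule finite_int_vec_norm_le)
qed

lemma torus_eigenvalue_iff_dual_form:
  "invertible A \<Longrightarrow> torus_eigenvalue A l \<longleftrightarrow> (\<exists>q. l = 4 * pi\<^sup>2 * dual_form A q)"
  by (simp add: torus_eigenvalue_iff dual_form_def)

text \<open>Induction on the finite number of eigenvalues below \<open>l\<close>: the largest of
  them has an index by induction, and \<open>l\<close> is the next one. This also exhibits the
  minimum that \<open>LEAST\<close> refers to on the reals.\<close>

lemma ex_nth_eigenvalue:
  fixes A :: "real ^ 'n ^ 'n"
  assumes A: "invertible A" and "torus_eigenvalue A l"
  shows "\<exists>i. nth_eigenvalue A i = l"
proof -
  define S where "S l = {l'. torus_eigenvalue A l' \<and> l' < l}" for l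
  have fin: "finite (S l)" for l
  proof (rule finite_subset)
    show "S l \<subseteq> (\<lambda>q. 4 * pi\<^sup>2 * dual_form A q) ` {q. dual_form A q \<le> l / (4 * pi\<^sup>2)}"
      by (auto simp: S_def torus_eigenvalue_iff_dual_form[OF A] field_simps)
  qed (intro finite_imageI finite_dual_form_le A)
  show ?thesis using assms(2)
  proof (induction "card (S l)" arbitrary: l rule: less_induct)
    case less
    show ?case
    proof (cases "l = 0")
      case True
      then show ?thesis using nth_eigenvalue.simps(1) by blast
    next
      case False
      then have "0 < l"
        using less.prems dual_form_nonneg[OF A] 
        by (auto simp: torus_eigenvalue_iff_dual_form[OF A] zero_less_mult_iff less_le)
      moreover have "torus_eigenvalue A 0"
        using dual_form_eq_0_iff[OF A, of 0] by (auto simp: torus_eigenvalue_iff_dual_form[OF A] intro!: exI[of _ 0])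
      ultimately have "0 \<in> S l" by (simp add: S_def)
      define m where "m = Max (S l)"
      have m: "m \<in> S l" "\<And>l'. l' \<in> S l \<Longrightarrow> l' \<le> m"
        unfolding m_def using fin[of l] \<open>0 \<in> S l\<close> by (auto intro: Max_in)
      then have "S m \<subset> S l" by (auto simp: S_def)
      then obtain i where i: "nth_eigenvalue A i = m"
        using less.hyps[of m] psubset_card_mono[OF fin] m(1) by (auto simp: S_def)
      have "nth_eigenvalue A (Suc i) = l"
        unfolding nth_eigenvalue.simps i
      proof (rule Least_equality)
        show "torus_eigenvalue A l \<and> m < l" using m(1) less.prems by (simp add: S_def)
        show "l \<le> l'" if "torus_eigenvalue A l' \<and> m < l'" for l'
          using that m(2)[of l'] by (force simp: S_def)
      qed
      then show ?thesis ..
    qed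
  qed
qed

lemma nth_eigenvalue_cong:
  "torus_eigenvalue A = torus_eigenvalue B \<Longrightarrow> nth_eigenvalue A i = nth_eigenvalue B i"
  by (induction i) simp_all

section \<open>From nodal sequences to values on spheres\<close>

lemma count_image_mset_set:
  assumes "finite S"
  shows "count (image_mset f (mset_set S)) x = card {y \<in> S. f y = x}"
proof -
  have "f -` {x} \<inter> S = {y \<in> S. f y = x}" by auto
  then show ?thesis using assms by (simp add: count_image_mset)
qed

lemma count_nodal_sequence:
  fixes A :: "real ^ 'n ^ 'n"
  assumes A: "invertible A" and P: "P = Re \<or> P = Im" and "0 \<le> k"
  shows "count (nodal_sequence P A i) (2 * nat k + (if P = Re then 1 else 0))
       = card {q. nth_eigenvalue A i = 4 * pi\<^sup>2 * dual_form A q \<and> l1_norm q = k}"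
proof -
  let ?l = "nth_eigenvalue A i"
  have fin: "finite (representing_vectors A ?l)"
    by (rule finite_subset[OF _ finite_dual_form_le[OF A, of "?l / (4 * pi\<^sup>2)"]])
      (auto simp: representing_vectors_def dual_form_def)
  have nonneg: "0 \<le> l1_norm q" for q :: "int ^ 'n" by (simp add: l1_norm_def sum_nonneg)
  define n where "n = 2 * nat k + (if P = Re then 1 else 0)"
  have "nodal_count P A q = n \<longleftrightarrow> l1_norm q = k" for q
    using nonneg[of q] \<open>0 \<le> k\<close> by (auto simp: nodal_count_eq[OF A P] n_def)
  then have "{q \<in> representing_vectors A ?l. nodal_count P A q = n}
      = {q. ?l = 4 * pi\<^sup>2 * dual_form A q \<and> l1_norm q = k}"
    by (auto simp: representing_vectors_def dual_form_def)
  then show ?thesis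
    unfolding nodal_sequence_def n_def[symmetric] count_image_mset_set[OF fin] by simp
qed

lemma finite_l1_norm_eq: "finite {q :: int ^ 'n. l1_norm q = k}"
proof (rule finite_subset[OF _ finite_int_vec_norm_le[of "real_of_int k"]])
  have "norm (int_vec q) \<le> real_of_int (l1_norm q)" for q :: "int ^ 'n"
    using norm_le_l1_cart[of "int_vec q"] by (simp add: int_vec_def l1_norm_def)
  then show "{q. l1_norm q = k} \<subseteq> {q :: int ^ 'n. norm (int_vec q) \<le> real_of_int k}" by auto
qed

text \<open>Equal ranges make equal indices refer to equal eigenvalues. The multiplicity of the
  nodal count of radius \<open>k\<close> at such an index then counts the vectors on the sphere with
  the given value of the form.\<close>

lemma nodal_sequences_eq_imp:
  fixes A B :: "real ^ 'n ^ 'n"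
  assumes A: "invertible A" and B: "invertible B" and P: "P = Re \<or> P = Im"
    and range: "range (dual_form A) = range (dual_form B)"
    and eq: "\<And>i. 1 \<le> i \<Longrightarrow> nodal_sequence P A i = nodal_sequence P B i"
    and "0 < k"
  shows "image_mset (dual_form A) (mset_set {q. l1_norm q = k})
       = image_mset (dual_form B) (mset_set {q. l1_norm q = k})"
proof (rule multiset_eqI)
  fix x
  have ev: "torus_eigenvalue A = torus_eigenvalue B"
    unfolding fun_eq_iff torus_eigenvalue_iff_dual_form[OF A] torus_eigenvalue_iff_dual_form[OF B]
    using range by (metis rangeE rangeI)
  have "card {q. dual_form A q = x \<and> l1_norm q = k} = card {q. dual_form B q = x \<and> l1_norm q = k}"
  proof (cases "x \<in> range (dual_form A) \<and> x \<noteq> 0")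
    case True
    then have "torus_eigenvalue A (4 * pi\<^sup>2 * x)"
      by (auto simp: torus_eigenvalue_iff_dual_form[OF A])
    then obtain i where i: "nth_eigenvalue A i = 4 * pi\<^sup>2 * x" using ex_nth_eigenvalue[OF A] by blast
    \<comment> \<open>Index 0 carries the eigenvalue 0, while \<open>x\<close> is nonzero
      here.\<close>
    with True have "1 \<le> i" by (cases i) auto
    have "nth_eigenvalue B i = 4 * pi\<^sup>2 * x" using i nth_eigenvalue_cong[OF ev] by simp
    have "{q. dual_form C q = x \<and> l1_norm q = k} = {q. 4 * pi\<^sup>2 * x = 4 * pi\<^sup>2 * dual_form C q \<and> l1_norm q = k}"
      for C :: "real ^ 'n ^ 'n" by auto
    with count_nodal_sequence[OF A P, of k i] count_nodal_sequence[OF B P, of k i] show ?thesis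
      unfolding i \<open>nth_eigenvalue B i = _\<close> eq[OF \<open>1 \<le> i\<close>] using \<open>0 < k\<close> by simp
  next
    case False
    \<comment> \<open>The value 0 is taken only at the origin, which lies on no sphere of positive
      radius.\<close>
    have "l1_norm q \<noteq> k" if "dual_form A q = x \<or> dual_form B q = x" for q
    proof -
      have "q = 0"
        using that False range dual_form_eq_0_iff[OF A] dual_form_eq_0_iff[OF B] by auto
      then show ?thesis using \<open>0 < k\<close> by (simp add: l1_norm_def)
    qed
    then have "{q. dual_form A q = x \<and> l1_norm q = k} = {}" "{q. dual_form B q = x \<and> l1_norm q = k} = {}"
      by auto
    then show ?thesis by (simp only:)
  qed
  moreover have "{q \<in> {q. l1_norm q = k}. dual_form C q = x} = {q. dual_form C q = x \<and> l1_norm q = k}"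
    for C :: "real ^ 'n ^ 'n" by auto
  ultimately show "count (image_mset (dual_form A) (mset_set {q. l1_norm q = k})) x
      = count (image_mset (dual_form B) (mset_set {q. l1_norm q = k})) x"
    by (simp only: count_image_mset_set[OF finite_l1_norm_eq])
qed

section \<open>The Conway-Sloane forms\<close>

definition plus_squares :: "int \<times> int \<times> int \<times> int \<Rightarrow> int \<times> int \<times> int \<times> int" where
  "plus_squares = (\<lambda>(x, y, z, w).
     ((3*x + y + z + w)\<^sup>2, (x - 3*y + z - w)\<^sup>2, (x - y - 3*z + w)\<^sup>2, (x + y - z - 3*w)\<^sup>2))"

definition minus_squares :: "int \<times> int \<times> int \<times> int \<Rightarrow> int \<times> int \<times> int \<times> int" where
  "minus_squares = (\<lambda>(x, y, z, w).
     ((- 3*x + y + z + w)\<^sup>2, (x + 3*y + z - w)\<^sup>2, (x - y + 3*z + w)\<^sup>2, (x + y - z + 3*w)\<^sup>2))"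

definition weighted :: "real \<Rightarrow> real \<Rightarrow> real \<Rightarrow> real \<Rightarrow> int \<times> int \<times> int \<times> int \<Rightarrow> real" where
  "weighted a b c d = (\<lambda>(p, q, r, s). a * p + b * q + c * r + d * s)"

text \<open>Quadruples replace vectors so that spheres can be enumerated by evaluation.\<close>

definition entries :: "'a ^ 4 \<Rightarrow> 'a \<times> 'a \<times> 'a \<times> 'a" where
  "entries q = (q $ 1, q $ 2, q $ 3, q $ 4)"

lemma inj_entries: "inj entries"
  by (auto simp: inj_on_def entries_def vec_eq_iff forall_4)

lemma surj_entries: "surj (entries :: 'a::zero ^ 4 \<Rightarrow> _)"
proof -
  have "(x, y, z, w) = entries (vector [x, y, z, w])" for x y z w :: 'a
    by (simp add: entries_def vector_4_nth)
  then show ?thesis by (metis surjI surj_pair prod_cases4 surj_def)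
qed

lemma Q_plus_form:
  "x \<bullet> (Q_plus a b c d *v x) =
     (a * (3*x$1 + x$2 + x$3 + x$4)\<^sup>2 + b * (x$1 - 3*x$2 + x$3 - x$4)\<^sup>2
      + c * (x$1 - x$2 - 3*x$3 + x$4)\<^sup>2 + d * (x$1 + x$2 - x$3 - 3*x$4)\<^sup>2) / 12"
proof -
  have "12 * (x \<bullet> (Q_plus a b c d *v x)) =
     a * (3*x$1 + x$2 + x$3 + x$4)\<^sup>2 + b * (x$1 - 3*x$2 + x$3 - x$4)\<^sup>2
      + c * (x$1 - x$2 - 3*x$3 + x$4)\<^sup>2 + d * (x$1 + x$2 - x$3 - 3*x$4)\<^sup>2"
    by (simp add: Q_plus_def inner_vec_def matrix_vector_mult_def sum_4 vector_4_nth) algebra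
  then show ?thesis by simp
qed

text \<open>The substitution \<open>u = U_mat *v x\<close> in the formula for \<open>Q_plus\<close>;
  the halves cancel in the four linear forms, so these are integral on integer vectors.\<close>

lemma Q_minus_form:
  "x \<bullet> (Q_minus a b c d *v x) =
     (a * (- 3*x$1 + x$2 + x$3 + x$4)\<^sup>2 + b * (x$1 + 3*x$2 + x$3 - x$4)\<^sup>2
      + c * (x$1 - x$2 + 3*x$3 + x$4)\<^sup>2 + d * (x$1 + x$2 - x$3 + 3*x$4)\<^sup>2) / 12"
proof -
  define u where "u = U_mat *v x"
  have u: "u $ 1 = (- x$1 + x$2 + x$3 + x$4) / 2" "u $ 2 = (- x$1 - x$2 - x$3 + x$4) / 2"
    "u $ 3 = (- x$1 + x$2 - x$3 - x$4) / 2" "u $ 4 = (- x$1 - x$2 + x$3 - x$4) / 2"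
    by (simp_all add: u_def U_mat_def matrix_vector_mult_def sum_4 vector_4_nth)
  have "x \<bullet> (Q_minus a b c d *v x) = u \<bullet> (Q_plus a b c d *v u)"
    by (simp add: Q_minus_def u_def dot_lmul_matrix flip: matrix_vector_mul_assoc)
       (metis dot_lmul_matrix inner_commute transpose_matrix_vector transpose_transpose)
  moreover have "3*u$1 + u$2 + u$3 + u$4 = - 3*x$1 + x$2 + x$3 + x$4"
    "u$1 - 3*u$2 + u$3 - u$4 = x$1 + 3*x$2 + x$3 - x$4"
    "u$1 - u$2 - 3*u$3 + u$4 = x$1 - x$2 + 3*x$3 + x$4"
    "u$1 + u$2 - u$3 - 3*u$4 = x$1 + x$2 - x$3 + 3*x$4"
    unfolding u by (simp_all add: field_simps)
  ultimately show ?thesis by (simp only: Q_plus_form)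
qed

lemma Q_plus_int_vec:
  "int_vec q \<bullet> (Q_plus a b c d *v int_vec q) = weighted a b c d (plus_squares (entries q)) / 12"
  by (simp add: Q_plus_form weighted_def plus_squares_def entries_def int_vec_def)

lemma Q_minus_int_vec:
  "int_vec q \<bullet> (Q_minus a b c d *v int_vec q) = weighted a b c d (minus_squares (entries q)) / 12"
  by (simp add: Q_minus_form weighted_def minus_squares_def entries_def int_vec_def)

section \<open>Equality of the sets of values\<close>

text \<open>Up to sign, these four are all the nonzero linear forms in two variables over the field
  with three elements, and every vector is annihilated by one of them.\<close>

lemma three_dvd_cases: "3 dvd m \<or> 3 dvd n \<or> 3 dvd m + n \<or> 3 dvd m - n" for m n :: int
  by presburger

text \<open>
  If the coordinate sum of \<open>q\<close> is even, then \<open>Uq\<close> is integral and has the required squares. If it is odd,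
  then \<open>Uq\<close> is half-integral and all coordinates of \<open>v = BUq\<close> are odd. Modulo 3 some coordinate \<open>v\<^sub>i\<close>
  vanishes; flipping its sign amounts to subtracting \<open>v\<^sub>i/6\<close> times the \<open>i\<close>-th row of \<open>B\<close> from \<open>Uq\<close>, which
  makes it integral. The converse uses \<open>U\<^sup>T\<close> and \<open>BU\<close> in the same way.
\<close>

lemma ex_plus_squares:
  fixes x y z w :: int
  shows "\<exists>t. plus_squares t = minus_squares (x, y, z, w)"
proof (cases "even (x + y + z + w)")
  case True
  then obtain s where "x + y + z + w = 2 * s" by (rule evenE)
  then have s: "w = 2 * s - x - y - z" by simp
  have "plus_squares (s - x, w - s, y - s, z - s) = minus_squares (x, y, z, w)"
    by (simp add: plus_squares_def minus_squares_def s algebra_simps)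
  then show ?thesis by blast
next
  case False
  then obtain s where "x + y + z + w = 2 * s + 1" by (rule oddE)
  then have s: "w = 2 * s + 1 - x - y - z" by simp
  \<comment> \<open>Modulo 3 the four linear expressions below are, up to sign, the two chosen
    numbers, their sum and their difference. All four are odd, so a multiple of 3 has the form
    \<open>6*n + 3\<close>.\<close>
  from three_dvd_cases[of "s - 1 + x" "s - 1 - y + z"]
  obtain n where "- 3*x + y + z + w = 6*n + 3 \<or> x + 3*y + z - w = 6*n + 3 \<or> x - y + 3*z + w = 6*n + 3 \<or> x + y - z + 3*w = 6*n + 3"
  proof (elim disjE dvdE)
    fix m assume "s - 1 + x = 3 * m"
    then show ?thesis using s by (intro that[of "m - x"]) auto
  next
    fix m assume "s - 1 - y + z = 3 * m"
    then show ?thesis using s by (intro that[of "m"]) auto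
  next
    fix m assume "s - 1 + x + (s - 1 - y + z) = 3 * m"
    then show ?thesis using s by (intro that[of "m - s + y"]) auto
  next
    fix m assume "s - 1 + x - (s - 1 - y + z) = 3 * m"
    then show ?thesis using s by (intro that[of "s - m - z"]) auto
  qed
  then show ?thesis
  proof (elim disjE)
    assume n: "- 3*x + y + z + w = 6*n + 3"
    \<comment> \<open>The witness is the half-integral \<open>Uq\<close> minus
      \<open>n + 1/2\<close> times the first row \<open>(3, 1, 1, 1)\<close> of \<open>B\<close>;
      the other cases use the other rows.\<close>
    show ?thesis
      by (rule exI[of _ "(s - x - 3*n - 1, w - s - n - 1, y - s - n - 1, z - s - n - 1)"])
        (use n s in \<open>auto simp: plus_squares_def minus_squares_def power2_eq_iff\<close>)
  next
    assume n: "x + 3*y + z - w = 6*n + 3"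
    show ?thesis
      by (rule exI[of _ "(s - x - n, w - s + 3*n + 1, y - s - n - 1, z - s + n)"])
        (use n s in \<open>auto simp: plus_squares_def minus_squares_def power2_eq_iff\<close>)
  next
    assume n: "x - y + 3*z + w = 6*n + 3"
    show ?thesis
      by (rule exI[of _ "(s - x - n, w - s + n, y - s + 3*n + 1, z - s - n - 1)"])
        (use n s in \<open>auto simp: plus_squares_def minus_squares_def power2_eq_iff\<close>)
  next
    assume n: "x + y - z + 3*w = 6*n + 3"
    show ?thesis
      by (rule exI[of _ "(s - x - n, w - s - n - 1, y - s + n, z - s + 3*n + 1)"])
        (use n s in \<open>auto simp: plus_squares_def minus_squares_def power2_eq_iff\<close>)
  qed
qed

lemma ex_minus_squares:
  fixes x y z w :: int
  shows "\<exists>t. minus_squares t = plus_squares (x, y, z, w)"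
proof (cases "even (x + y + z + w)")
  case True
  then obtain s where "x + y + z + w = 2 * s" by (rule evenE)
  then have s: "w = 2 * s - x - y - z" by simp
  have "minus_squares (- s, x + z - s, x + w - s, x + y - s) = plus_squares (x, y, z, w)"
    by (simp add: plus_squares_def minus_squares_def s algebra_simps)
  then show ?thesis by blast
next
  case False
  then obtain s where "x + y + z + w = 2 * s + 1" by (rule oddE)
  then have s: "w = 2 * s + 1 - x - y - z" by simp
  from three_dvd_cases[of "x + s - 1" "s - 1 - y - 2*z"]
  obtain n where "3*x + y + z + w = 6*n + 3 \<or> x - 3*y + z - w = 6*n + 3 \<or> x - y - 3*z + w = 6*n + 3 \<or> x + y - z - 3*w = 6*n + 3"
  proof (elim disjE dvdE)
    fix m assume "x + s - 1 = 3 * m"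
    then show ?thesis using s by (intro that[of "m"]) auto
  next
    fix m assume "s - 1 - y - 2*z = 3 * m"
    then show ?thesis using s by (intro that[of "m"]) auto
  next
    fix m assume "x + s - 1 + (s - 1 - y - 2*z) = 3 * m"
    then show ?thesis using s by (intro that[of "m - s + z"]) auto
  next
    fix m assume "x + s - 1 - (s - 1 - y - 2*z) = 3 * m"
    then show ?thesis using s by (intro that[of "x + y + z - s - 1 - m"]) auto
  qed
  then show ?thesis
  proof (elim disjE)
    assume n: "3*x + y + z + w = 6*n + 3"
    \<comment> \<open>Here \<open>n + 1/2\<close> times the first row \<open>(-3, 1, 1, 1)\<close>
      of \<open>BU\<close> is subtracted from the transpose of \<open>U\<close> applied to
      \<open>q\<close>.\<close>
    show ?thesis
      by (rule exI[of _ "(- s + 3*n + 1, x + z - s - n - 1, x + w - s - n - 1, x + y - s - n - 1)"])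
        (use n s in \<open>auto simp: plus_squares_def minus_squares_def power2_eq_iff\<close>)
  next
    assume n: "x - 3*y + z - w = 6*n + 3"
    show ?thesis
      by (rule exI[of _ "(- s - n - 1, x + z - s - 3*n - 2, x + w - s - n - 1, x + y - s + n)"])
        (use n s in \<open>auto simp: plus_squares_def minus_squares_def power2_eq_iff\<close>)
  next
    assume n: "x - y - 3*z + w = 6*n + 3"
    show ?thesis
      by (rule exI[of _ "(- s - n - 1, x + z - s + n, x + w - s - 3*n - 2, x + y - s - n - 1)"])
        (use n s in \<open>auto simp: plus_squares_def minus_squares_def power2_eq_iff\<close>)
  next
    assume n: "x + y - z - 3*w = 6*n + 3"
    show ?thesis
      by (rule exI[of _ "(- s - n - 1, x + z - s - n - 1, x + w - s + n, x + y - s - 3*n - 2)"])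
        (use n s in \<open>auto simp: plus_squares_def minus_squares_def power2_eq_iff\<close>)
  qed
qed

text \<open>Independently of \<open>a, b, c, d\<close>, both forms thus take the same values, so
  equal indices denote equal eigenvalues of the two tori.\<close>

lemma range_plus_squares_eq: "range plus_squares = range minus_squares"
proof
  show "range plus_squares \<subseteq> range minus_squares"
    using ex_minus_squares by (metis (no_types) image_subsetI prod_cases4 rangeI)
  show "range minus_squares \<subseteq> range plus_squares"
    using ex_plus_squares by (metis (no_types) image_subsetI prod_cases4 rangeI)
qed

section \<open>The sphere of radius 4 and its eighth power sums\<close>

text \<open>The separate case \<open>r = 0\<close> keeps the enumeration of the sphere free of
  repetitions, so that multiplicities are counted correctly.\<close>

definition plus_minus :: "int \<Rightarrow> int list" where
  "plus_minus r = (if r = 0 then [0] else [r, - r])"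

definition l1_sphere :: "int \<Rightarrow> (int \<times> int \<times> int \<times> int) list" where
  "l1_sphere k = concat (map (\<lambda>x. concat (map (\<lambda>y. concat (map (\<lambda>z.
     map (\<lambda>w. (x, y, z, w)) (plus_minus (k - \<bar>x\<bar> - \<bar>y\<bar> - \<bar>z\<bar>)))
       [\<bar>x\<bar> + \<bar>y\<bar> - k..k - \<bar>x\<bar> - \<bar>y\<bar>])) [\<bar>x\<bar> - k..k - \<bar>x\<bar>])) [- k..k])"

lemma set_l1_sphere: "set (l1_sphere k) = {(x, y, z, w). \<bar>x\<bar> + \<bar>y\<bar> + \<bar>z\<bar> + \<bar>w\<bar> = k}"
proof -
  have "(x, y, z, w) \<in> set (l1_sphere k) \<longleftrightarrow> \<bar>x\<bar> + \<bar>y\<bar> + \<bar>z\<bar> + \<bar>w\<bar> = k" for x y z w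
  proof -
    have "v \<in> set (plus_minus r) \<longleftrightarrow> v = r \<or> v = - r" for v r
      by (auto simp: plus_minus_def)
    moreover have "(x, y, z, w) \<in> (\<lambda>w. (p, q, r, w)) ` S \<longleftrightarrow> p = x \<and> q = y \<and> r = z \<and> w \<in> S" for p q r S
      by auto
    ultimately have "(x, y, z, w) \<in> set (l1_sphere k) \<longleftrightarrow>
        - k \<le> x \<and> x \<le> k \<and> \<bar>x\<bar> - k \<le> y \<and> y \<le> k - \<bar>x\<bar>
        \<and> \<bar>x\<bar> + \<bar>y\<bar> - k \<le> z \<and> z \<le> k - \<bar>x\<bar> - \<bar>y\<bar>
        \<and> (w = k - \<bar>x\<bar> - \<bar>y\<bar> - \<bar>z\<bar> \<or> w = - (k - \<bar>x\<bar> - \<bar>y\<bar> - \<bar>z\<bar>))"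
      unfolding l1_sphere_def by (simp add: Bex_def)
    then show ?thesis by (smt (verit))
  qed
  then show ?thesis by auto
qed

lemma distinct_concat_map:
  assumes "distinct xs" "\<And>x. distinct (f x)" "\<And>x y t. t \<in> set (f x) \<Longrightarrow> t \<in> set (f y) \<Longrightarrow> x = y"
  shows "distinct (concat (map f xs))"
  using assms(1) by (induction xs) (use assms(2,3) in auto)

lemma distinct_l1_sphere: "distinct (l1_sphere k)"
  unfolding l1_sphere_def
  by (intro distinct_concat_map distinct_upto) (auto simp: distinct_map inj_on_def plus_minus_def)

text \<open>
  The coefficient vectors on the sphere of radius 4 that occur for one of the two forms only, each of them
  for two vectors \<open>\<plusminus>q\<close>.
\<close>

definition chiral_plus :: "(int \<times> int \<times> int \<times> int) list" where
  "chiral_plus =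
   [(0, 4, 100, 16), (0, 16, 4, 100), (0, 100, 16, 4), (4, 0, 16, 100), (4, 16, 36, 64), (4, 16, 100, 0),
    (4, 36, 64, 16), (4, 64, 16, 36), (4, 100, 0, 16), (16, 0, 100, 4), (16, 4, 0, 100), (16, 4, 64, 36),
    (16, 36, 4, 64), (16, 64, 36, 4), (16, 100, 4, 0), (36, 4, 16, 64), (36, 16, 64, 4), (36, 64, 4, 16),
    (64, 4, 36, 16), (64, 16, 4, 36), (64, 36, 16, 4), (100, 0, 4, 16), (100, 4, 16, 0), (100, 16, 0, 4)]"

definition chiral_minus :: "(int \<times> int \<times> int \<times> int) list" where
  "chiral_minus =
   [(0, 4, 16, 100), (0, 16, 100, 4), (0, 100, 4, 16), (4, 0, 100, 16), (4, 16, 0, 100), (4, 16, 64, 36),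
    (4, 36, 16, 64), (4, 64, 36, 16), (4, 100, 16, 0), (16, 0, 4, 100), (16, 4, 36, 64), (16, 4, 100, 0),
    (16, 36, 64, 4), (16, 64, 4, 36), (16, 100, 0, 4), (36, 4, 64, 16), (36, 16, 4, 64), (36, 64, 16, 4),
    (64, 4, 16, 36), (64, 16, 36, 4), (64, 36, 4, 16), (100, 0, 16, 4), (100, 4, 0, 16), (100, 16, 4, 0)]"

text \<open>An arbitrary sorting key: only the equality of the two sorted lists matters.\<close>

definition encode :: "int \<times> int \<times> int \<times> int \<Rightarrow> int" where
  "encode = (\<lambda>(p, q, r, s). p + 256 * (q + 256 * (r + 256 * s)))"

text \<open>Each side receives the exceptional vectors of the other, twice because of the signs of
  \<open>q\<close>, which avoids subtracting multisets. All squares are at most 144, below the base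
  256 of \<open>encode\<close>, so equal multisets give equal sorted lists.\<close>

lemma sort_squares_l1_sphere:
  "sort_key encode (map plus_squares (l1_sphere 4) @ chiral_minus @ chiral_minus)
   = sort_key encode (map minus_squares (l1_sphere 4) @ chiral_plus @ chiral_plus)"
  by code_simp

text \<open>Swapping two variables swaps the two lists, so the difference is the Vandermonde product
  of degree 6 times a symmetric quadratic form. All coefficient vectors have sum 120 and the seventh
  power sums agree, so that form is invariant under a common shift of the variables: a multiple of
  the sum of squared differences.\<close>

lemma chiral_eighth_powers:
  "(\<Sum>t\<leftarrow>chiral_plus. weighted a b c d t ^ 8) - (\<Sum>t\<leftarrow>chiral_minus. weighted a b c d t ^ 8)
   = - 79906524364800 * ((a - b) * (a - c) * (a - d) * (b - c) * (b - d) * (c - d))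
      * ((a - b)\<^sup>2 + (a - c)\<^sup>2 + (a - d)\<^sup>2 + (b - c)\<^sup>2 + (b - d)\<^sup>2 + (c - d)\<^sup>2)"
  unfolding chiral_plus_def chiral_minus_def weighted_def
  by (simp only: list.map sum_list.Cons sum_list.Nil split_conv of_int_numeral of_int_0) algebra

lemma entries_l1_sphere: "image_mset entries (mset_set {q :: int ^ 4. l1_norm q = k}) = mset (l1_sphere k)"
proof -
  have "entries ` {q :: int ^ 4. l1_norm q = k} = set (l1_sphere k)"
  proof -
    have "{q :: int ^ 4. l1_norm q = k} = entries -` set (l1_sphere k)"
      by (auto simp: l1_norm_def sum_4 entries_def set_l1_sphere)
    then show ?thesis by (simp only: surj_image_vimage_eq[OF surj_entries])
  qed
  then show ?thesis
    by (simp add: image_mset_mset_set inj_on_subset[OF inj_entries] mset_set_set distinct_l1_sphere)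
qed

text \<open>After cancellation, the difference of the two sums is twice that over the chiral lists;
  its Vandermonde factor and its sum of squares are both nonzero.\<close>

lemma sum_list_eighth_powers_differ:
  assumes "distinct [a, b, c, d]"
  shows "(\<Sum>t\<leftarrow>l1_sphere 4. weighted a b c d (plus_squares t) ^ 8)
       \<noteq> (\<Sum>t\<leftarrow>l1_sphere 4. weighted a b c d (minus_squares t) ^ 8)"
proof
  let ?f = "\<lambda>t. weighted a b c d t ^ 8"
  assume eq: "(\<Sum>t\<leftarrow>l1_sphere 4. ?f (plus_squares t)) = (\<Sum>t\<leftarrow>l1_sphere 4. ?f (minus_squares t))"
  have "mset (map plus_squares (l1_sphere 4) @ chiral_minus @ chiral_minus)
      = mset (map minus_squares (l1_sphere 4) @ chiral_plus @ chiral_plus)"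
    using arg_cong[OF sort_squares_l1_sphere, of mset] by (simp only: mset_sort)
  from arg_cong[OF this, of "\<lambda>M. \<Sum>\<^sub># (image_mset ?f M)"]
  have "sum_list (map ?f (map plus_squares (l1_sphere 4) @ chiral_minus @ chiral_minus))
      = sum_list (map ?f (map minus_squares (l1_sphere 4) @ chiral_plus @ chiral_plus))"
    by (simp only: mset_map[symmetric] sum_mset_sum_list)
  then have "(\<Sum>t\<leftarrow>chiral_plus. ?f t) - (\<Sum>t\<leftarrow>chiral_minus. ?f t) = 0"
    using eq by (simp add: o_def)
  then have "(a - b) * (a - c) * (a - d) * (b - c) * (b - d) * (c - d) = 0
      \<or> (a - b)\<^sup>2 + (a - c)\<^sup>2 + (a - d)\<^sup>2 + (b - c)\<^sup>2 + (b - d)\<^sup>2 + (c - d)\<^sup>2 = 0"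
    unfolding chiral_eighth_powers by simp
  moreover have "0 < (a - b)\<^sup>2" using assms by simp
  then have "0 < (a - b)\<^sup>2 + (a - c)\<^sup>2 + (a - d)\<^sup>2 + (b - c)\<^sup>2 + (b - d)\<^sup>2 + (c - d)\<^sup>2"
    by (intro add_pos_nonneg) simp_all
  ultimately show False using assms by auto
qed

theorem mainTheorem1:
  fixes a b c d :: real
    and A_plus A_minus :: "real ^ 4 ^ 4"
    and P :: "complex \<Rightarrow> real"
  assumes "a > 0" "b > 0" "c > 0" "d > 0"
    and "distinct [a, b, c, d]"
    and "invertible A_plus" "inv_gram A_plus = Q_plus a b c d"
    and "invertible A_minus" "inv_gram A_minus = Q_minus a b c d"
    and "P = Re \<or> P = Im"
  shows "\<exists>i\<ge>1. nodal_sequence P A_plus i \<noteq> nodal_sequence P A_minus i"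
proof (rule ccontr)
  assume "\<not> (\<exists>i\<ge>1. nodal_sequence P A_plus i \<noteq> nodal_sequence P A_minus i)"
  then have eq: "nodal_sequence P A_plus i = nodal_sequence P A_minus i" if "1 \<le> i" for i
    using that by blast
  let ?w = "weighted a b c d"
  have plus: "dual_form A_plus = (\<lambda>t. ?w (plus_squares t) / 12) \<circ> entries"
    and minus: "dual_form A_minus = (\<lambda>t. ?w (minus_squares t) / 12) \<circ> entries"
    by (simp_all add: fun_eq_iff dual_form_def assms(7,9) Q_plus_int_vec Q_minus_int_vec)
  have range_form: "range ((\<lambda>t. ?w (g t) / 12) \<circ> entries) = (\<lambda>s. ?w s / 12) ` range g"
    for g :: "int \<times> int \<times> int \<times> int \<Rightarrow> int \<times> int \<times> int \<times> int"
    by (simp only: image_comp[symmetric] surj_entries) (simp add: image_image)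
  have "range (dual_form A_plus) = range (dual_form A_minus)"
    unfolding plus minus range_form by (simp add: range_plus_squares_eq)
  \<comment> \<open>Radius 4 is the first on which the two collections of coefficient vectors
    differ.\<close>
  from nodal_sequences_eq_imp[OF assms(6,8,10) this eq, of 4]
  have "image_mset (\<lambda>t. ?w (plus_squares t) / 12) (mset (l1_sphere 4))
      = image_mset (\<lambda>t. ?w (minus_squares t) / 12) (mset (l1_sphere 4))"
    unfolding plus minus by (simp add: entries_l1_sphere flip: image_mset.compositionality)
  \<comment> \<open>The factor 12 clears the denominator of the forms before the eighth powers are
    summed.\<close>
  from arg_cong[OF this, of "\<lambda>M. \<Sum>\<^sub># (image_mset (\<lambda>v. (12 * v) ^ 8) M)"]
  have "(\<Sum>t\<leftarrow>l1_sphere 4. ?w (plus_squares t) ^ 8) = (\<Sum>t\<leftarrow>l1_sphere 4. ?w (minus_squares t) ^ 8)"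
    by (simp add: image_mset.compositionality o_def power_divide sum_mset_sum_list flip: mset_map)
  with sum_list_eighth_powers_differ[OF assms(5)] show False by blast
qed

end
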